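(* Let $W=\{W(t):t\in[a,b]\}$ be a Brownian motion and let $L$ be the weak random operator $\langle Lf,h\rangle:=\varepsilon(f,h)=-\int_a^b f'(t)h'(t)\,dt+\int_a^b f(t)h'(t)W(t)\,dt$, $f,h\in H_1$. Almost surely, $L$ has a discrete spectrum in the following sense: the relation $$\langle Le,h\rangle=\langle\lambda e,h\rangle\quad\text{for all }h\in H_1$$ holds, with some nonzero $e\in H_1$, for a countable number of $\lambda\in\mathbb{R}$.
   Context: Fix real numbers $a<b$ and a Brownian motion $W=\{W(t):t\in[a,b]\}$ with continuous paths. Write $\langle f,g\rangle=\int_a^b f(x)g(x)\,dx$ for the inner product of $L_2[a,b]$. Let $H_1$ be the Sobolev space of absolutely continuous functions $h:[a,b]\to\mathbb{R}$ with $h,h'\in L_2[a,b]$ and $h(a)=h(b)=0$. The operator $L$ is formally $(Lf)(t)=f''(t)-W(t)f'(t)-W'(t)f(t)$; it is given rigorous meaning only through the bilinear form $\varepsilon$ in the claim, where $\langle Lf,h\rangle$ is just notation for $\varepsilon(f,h)$. The form is evaluated path by path, so $\lambda$ and $e$ may depend on the realization of $W$. *)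

theory Defs
  imports "HOL-Probability.Probability"
begin

(* No condition is put on W a and the increments are not required to be independent of it:
   this covers W a = 0 as well as the restriction to {a..b} of a one-sided or two-sided
   Brownian motion started elsewhere. Continuity is asked of almost every path only. *)
locale brownian_motion = prob_space M for M :: "'a measure" +
  fixes a b :: real and W :: "real \<Rightarrow> 'a \<Rightarrow> real"
  assumes random_variable_W:
      "\<And>t. t \<in> {a..b} \<Longrightarrow> random_variable borel (W t)"
    and normal_increments:
      "\<And>s t. a \<le> s \<Longrightarrow> s < t \<Longrightarrow> t \<le> b \<Longrightarrow>
         distributed M lborel (\<lambda>\<omega>. W t \<omega> - W s \<omega>) (normal_density 0 (sqrt (t - s)))"
    and indep_increments:
      "\<And>(n::nat) \<tau>. (\<And>i. i \<le> n \<Longrightarrow> \<tau> i \<in> {a..b}) \<Longrightarrow> (\<And>i. i < n \<Longrightarrow> \<tau> i \<le> \<tau> (Suc i)) \<Longrightarrow>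
         indep_vars (\<lambda>_. borel) (\<lambda>i \<omega>. W (\<tau> (Suc i)) \<omega> - W (\<tau> i) \<omega>) {..<n}"
    and continuous_paths:
      "AE \<omega> in M. continuous_on {a..b} (\<lambda>t. W t \<omega>)"

definition sq_integrable :: "real \<Rightarrow> real \<Rightarrow> (real \<Rightarrow> real) \<Rightarrow> bool" where
  "sq_integrable a b f \<longleftrightarrow>
     set_borel_measurable lebesgue {a..b} f \<and> set_integrable lebesgue {a..b} (\<lambda>t. (f t)\<^sup>2)"

definition L2_inner :: "real \<Rightarrow> real \<Rightarrow> (real \<Rightarrow> real) \<Rightarrow> (real \<Rightarrow> real) \<Rightarrow> real" where
  "L2_inner a b f g = (LINT t:{a..b}|lebesgue. f t * g t)"

(* Degenerate intervals l i = u i are allowed; they contribute nothing to either sum. *)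
definition abs_continuous :: "real \<Rightarrow> real \<Rightarrow> (real \<Rightarrow> real) \<Rightarrow> bool" where
  "abs_continuous a b f \<longleftrightarrow>
     (\<forall>\<epsilon>>0. \<exists>\<delta>>0. \<forall>(n::nat) l u.
        (\<forall>i<n. a \<le> l i \<and> l i \<le> u i \<and> u i \<le> b) \<longrightarrow>
        disjoint_family_on (\<lambda>i. {l i<..<u i}) {..<n} \<longrightarrow>
        (\<Sum>i<n. u i - l i) < \<delta> \<longrightarrow>
        (\<Sum>i<n. \<bar>f (u i) - f (l i)\<bar>) < \<epsilon>)"

(* A function on [a,b] is represented by any extension to the reals; its values outside [a,b]
   are irrelevant, since deriv h is used only up to the null set {a, b}. The a.e.
   differentiability clause is automatic for absolutely continuous h; it records that deriv h
   (unspecified where h is not differentiable) is the a.e. derivative of h. *)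
definition H1 :: "real \<Rightarrow> real \<Rightarrow> (real \<Rightarrow> real) set" where
  "H1 a b = {h. abs_continuous a b h \<and>
                (AE t in lebesgue. t \<in> {a<..<b} \<longrightarrow> h differentiable (at t)) \<and>
                sq_integrable a b h \<and> sq_integrable a b (deriv h) \<and>
                h a = 0 \<and> h b = 0}"

(* The form epsilon for one fixed realization w of the path. *)
definition eps_form ::
  "real \<Rightarrow> real \<Rightarrow> (real \<Rightarrow> real) \<Rightarrow> (real \<Rightarrow> real) \<Rightarrow> (real \<Rightarrow> real) \<Rightarrow> real" where
  "eps_form a b w f h =
     - (LINT t:{a..b}|lebesgue. deriv f t * deriv h t)
     + (LINT t:{a..b}|lebesgue. f t * deriv h t * w t)"

definition weak_eigenvalue :: "real \<Rightarrow> real \<Rightarrow> (real \<Rightarrow> real) \<Rightarrow> real \<Rightarrow> bool" where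
  "weak_eigenvalue a b w \<mu> \<longleftrightarrow>
     (\<exists>e\<in>H1 a b. (\<exists>t\<in>{a..b}. e t \<noteq> 0) \<and>
        (\<forall>h\<in>H1 a b. eps_form a b w e h = L2_inner a b (\<lambda>t. \<mu> * e t) h))"

end

theory Submission
  imports Defs
begin

text \<open>
  Fix a continuous path \<open>w\<close> and put \<open>p = exp (\<integral> w)\<close>, \<open>u = e / p\<close>. As \<open>e' - w e = p u'\<close>, the
  eigenvalue relation is the Sturm--Liouville problem \<open>(p u')' = \<mu> p u\<close>, \<open>u a = u b = 0\<close>, in weak form.

  Eigenfunctions for distinct \<open>\<mu>\<close> have derivatives \<open>u'\<close> that are orthogonal in \<open>L\<^sub>2(p)\<close>. Since
  \<open>u x\<close> is the \<open>L\<^sub>2(p)\<close>-product of \<open>u'\<close> with \<open>1 / p\<close> on \<open>[a,x]\<close>, Bessel's inequality shows that for each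
  rational \<open>x\<close> only countably many of them satisfy \<open>u x \<noteq> 0\<close>; hence there are countably many.

  For \<open>\<mu> = - s\<^sup>2\<close>, write \<open>B = s u\<close> and \<open>A = p u'\<close>, so that \<open>A' = - s p B\<close> and \<open>B' = s A / p\<close>. The angle of
  \<open>A + i B\<close> at \<open>b\<close> depends continuously on \<open>s\<close>, vanishes at \<open>s = 0\<close> and grows at least linearly, so it
  takes every value \<open>n \<pi>\<close>; there \<open>B b = 0\<close> and \<open>- s\<^sup>2\<close> is an eigenvalue.
\<close>

subsection \<open>The fundamental theorem of calculus for absolutely continuous functions\<close>

text \<open>Translates absolute continuity, which speaks of intervals indexed by numbers, into the
  language of tagged cells: enumerate \<open>q\<close> and take \<open>Inf\<close> and
  \<open>Sup\<close> of each cell as its endpoints. Disjoint interiors of the cells are exactly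
  disjointness of the open intervals.\<close>

lemma abs_continuous_sum_less:
  assumes "finite q" and lu: "\<And>x K. (x, K) \<in> q \<Longrightarrow> \<exists>u v. K = {u..v} \<and> u \<le> v \<and> a \<le> u \<and> v \<le> b"
    and disj: "\<And>y z. y \<in> q \<Longrightarrow> z \<in> q \<Longrightarrow> y \<noteq> z \<Longrightarrow> interior (snd y) \<inter> interior (snd z) = {}"
    and \<delta>: "\<And>(n::nat) l u. (\<forall>i<n. a \<le> l i \<and> l i \<le> u i \<and> u i \<le> b) \<Longrightarrow>
        disjoint_family_on (\<lambda>i. {l i<..<u i}) {..<n} \<Longrightarrow>
        (\<Sum>i<n. u i - l i) < \<delta> \<Longrightarrow> (\<Sum>i<n. \<bar>f (u i) - f (l i)\<bar>) < (\<epsilon>::real)"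
    and less: "(\<Sum>(x, K)\<in>q. measure lborel K) < \<delta>"
  shows "(\<Sum>(x, K)\<in>q. \<bar>f (Sup K) - f (Inf K :: real)\<bar>) < \<epsilon>"
proof -
  obtain g where g: "bij_betw g {..<card q} q"
    using ex_bij_betw_nat_finite[OF \<open>finite q\<close>] by (auto simp: atLeast0LessThan)
  define l where "l i = Inf (snd (g i))" for i
  define u where "u i = Sup (snd (g i))" for i
  have gK: "a \<le> l i \<and> l i \<le> u i \<and> u i \<le> b \<and> snd (g i) = {l i..u i}" if "i < card q" for i
  proof -
    have "g i \<in> q" using g that by (auto simp: bij_betw_def)
    then have "(fst (g i), snd (g i)) \<in> q" by simp
    from lu[OF this] obtain v w where "snd (g i) = {v..w}" "v \<le> w" "a \<le> v" "w \<le> b" by blast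
    then show ?thesis by (simp add: l_def u_def)
  qed
  have "disjoint_family_on (\<lambda>i. {l i<..<u i}) {..<card q}"
    unfolding disjoint_family_on_def
  proof (intro ballI impI)
    fix i j assume ij: "i \<in> {..<card q}" "j \<in> {..<card q}" "i \<noteq> j"
    then have "g i \<in> q" "g j \<in> q" "g i \<noteq> g j"
      using g by (auto simp: bij_betw_def inj_on_def)
    from disj[OF this] gK[of i] gK[of j] ij show "{l i<..<u i} \<inter> {l j<..<u j} = {}"
      by (simp add: interior_atLeastAtMost_real)
  qed
  moreover have "(\<Sum>i<card q. u i - l i) = (\<Sum>(x, K)\<in>q. measure lborel K)"
  proof -
    have "(\<Sum>(x, K)\<in>q. measure lborel K) = (\<Sum>i<card q. measure lborel (snd (g i)))"
      by (subst sum.reindex_bij_betw[OF g, symmetric]) (simp add: split_def)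
    also have "\<dots> = (\<Sum>i<card q. u i - l i)"
      by (intro sum.cong refl) (simp add: gK)
    finally show ?thesis by simp
  qed
  ultimately have "(\<Sum>i<card q. \<bar>f (u i) - f (l i)\<bar>) < \<epsilon>"
    using less gK by (intro \<delta>) auto
  moreover have "(\<Sum>(x, K)\<in>q. \<bar>f (Sup K) - f (Inf K)\<bar>) = (\<Sum>i<card q. \<bar>f (u i) - f (l i)\<bar>)"
    by (subst sum.reindex_bij_betw[OF g, symmetric]) (simp add: split_def u_def l_def)
  ultimately show ?thesis by simp
qed

text \<open>The gauge integral is used because it yields integrability of \<open>f'\<close> together
  with its value; nothing about \<open>f'\<close> has to be known beforehand.\<close>

theorem abs_continuous_has_integral:
  assumes ab: "a \<le> b" and ac: "abs_continuous a b f" and N: "negligible N"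
    and deriv: "\<And>t. t \<in> {a..b} - N \<Longrightarrow> (f has_real_derivative f' t) (at t within {a..b})"
  shows "(f' has_integral (f b - f a)) {a..b}"
proof -
  define g where "g t = (if t \<in> N then 0 else f' t)" for t
  (* Tags in N are given a gauge inside an open set of small measure, where absolute continuity
     controls the increments of f; the other tags are handled by differentiability. *)
  have "(g has_integral (f b - f a)) {a..b}"
    unfolding has_integral_real
  proof (intro allI impI)
    fix e :: real assume e: "e > 0"
    \<comment> \<open>Chosen so that \<open>e1 * (b - a) < e / 2\<close>; the added 1 keeps the
      denominator positive when \<open>a = b\<close>.\<close>
    define e1 where "e1 = e / (2 * (b - a + 1))"
    have e1: "e1 > 0" using e ab by (simp add: e1_def)
    have "\<exists>d>0. x \<in> {a..b} - N \<longrightarrow> (\<forall>y\<in>{a..b}. \<bar>y - x\<bar> < d \<longrightarrow>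
       \<bar>f y - f x - (y - x) * f' x\<bar> \<le> e1 * \<bar>y - x\<bar>)" for x
    proof (cases "x \<in> {a..b} - N")
      case True
      from deriv[OF this, unfolded has_field_derivative_def has_derivative_within_alt] e1
      show ?thesis by (auto simp: mult.commute)
    qed (auto intro: exI[of _ 1])
    then obtain d where d: "\<And>x. d x > 0"
      "\<And>x y. x \<in> {a..b} - N \<Longrightarrow> y \<in> {a..b} \<Longrightarrow> \<bar>y - x\<bar> < d x \<Longrightarrow>
         \<bar>f y - f x - (y - x) * f' x\<bar> \<le> e1 * \<bar>y - x\<bar>"
      by metis
    have "e / 2 > 0" using e by simp
    from ac[unfolded abs_continuous_def, rule_format, OF this] obtain \<delta> where "\<delta> > 0" and \<delta>: "\<And>(n::nat) l u. (\<forall>i<n. a \<le> l i \<and> l i \<le> u i \<and> u i \<le> b) \<Longrightarrow>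
        disjoint_family_on (\<lambda>i. {l i<..<u i}) {..<n} \<Longrightarrow>
        (\<Sum>i<n. u i - l i) < \<delta> \<Longrightarrow> (\<Sum>i<n. \<bar>f (u i) - f (l i)\<bar>) < e / 2"
      by blast
    from N have "N \<in> lmeasurable" "measure lebesgue N = 0"
      by (auto simp: negligible_imp_measurable negligible_imp_measure0)
    obtain U where U: "open U" "N \<subseteq> U" "U - N \<in> lmeasurable" "emeasure lebesgue (U - N) < ennreal \<delta>"
      using sets_lebesgue_outer_open[OF _ \<open>\<delta> > 0\<close>] \<open>N \<in> lmeasurable\<close> by (metis fmeasurableD)
    have "U = (U - N) \<union> N" using U(2) by auto
    then have Um: "U \<in> lmeasurable" "measure lebesgue U \<le> measure lebesgue (U - N) + measure lebesgue N"
      using U(3) \<open>N \<in> lmeasurable\<close> by (metis fmeasurable.Un, metis measure_Un_le fmeasurableD)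
    have "measure lebesgue (U - N) < \<delta>"
      using U(3,4) \<open>\<delta> > 0\<close> by (simp add: emeasure_eq_measure2 ennreal_less_iff)
    then have U\<delta>: "measure lebesgue U < \<delta>" using Um(2) \<open>measure lebesgue N = 0\<close> by simp
    define \<gamma> where "\<gamma> x = (if x \<in> N then U else ball x (d x))" for x
    have "gauge \<gamma>" using U d(1) by (auto simp: gauge_def \<gamma>_def)
    moreover have "norm ((\<Sum>(x,k)\<in>\<D>. measure lborel k *\<^sub>R g x) - (f b - f a)) < e"
      if td: "\<D> tagged_division_of {a..b}" and fine: "\<gamma> fine \<D>" for \<D>
    proof -
      have fin: "finite \<D>" using td by auto
      have lu: "\<exists>u v. K = {u..v} \<and> u \<le> v \<and> a \<le> u \<and> v \<le> b \<and> x \<in> {u..v}" if xK: "(x, K) \<in> \<D>" for x K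
      proof -
        obtain u v where K: "K = {u..v}" using tagged_division_ofD(4)[OF td xK] by auto
        have "x \<in> {u..v}" "{u..v} \<subseteq> {a..b}"
          using tagged_division_ofD(2,3)[OF td xK] K by auto
        then have "u \<le> v" "a \<le> u" "v \<le> b" by auto
        with K \<open>x \<in> {u..v}\<close> show ?thesis by blast
      qed
      define q where "q = {(x, K) \<in> \<D>. x \<in> N}"
      have q: "q \<subseteq> \<D>" "finite q" using fin by (auto simp: q_def intro: finite_subset)
      have "q tagged_partial_division_of {a..b}"
        using td q(1) by (meson tagged_division_of_def tagged_partial_division_subset)
      then have tq: "q tagged_division_of \<Union>(snd ` q)"
        by (rule tagged_partial_division_of_Union_self)
      \<comment> \<open>Two tags may share a cell only if its interior is empty, so the sum over
        pairs equals the sum over cells. That is the measure of their union, and fineness puts this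
        union inside \<open>U\<close>.\<close>
      have "(\<Sum>(x, K)\<in>q. measure lborel K) = (\<Sum>K\<in>snd ` q. measure lborel K)"
        by (rule sum.over_tagged_division_lemma[OF tq]) (simp add: content_eq_0_interior)
      also have "\<dots> = (\<Sum>K\<in>snd ` q. measure lebesgue K)"
      proof (intro sum.cong refl)
        fix K assume "K \<in> snd ` q"
        then obtain x where "(x, K) \<in> \<D>" using q(1) by auto
        from lu[OF this] obtain u v where "K = {u..v}" by blast
        then show "measure lborel K = measure lebesgue K" by (simp add: measure_completion)
      qed
      also have "\<dots> = measure lebesgue (\<Union>(snd ` q))"
        using content_division[OF division_of_tagged_division[OF tq]] by simp
      also have "\<dots> \<le> measure lebesgue U"
      proof (rule measure_mono_fmeasurable[OF _ _ Um(1)])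
        have "snd z \<subseteq> U" if "z \<in> q" for z
        proof -
          have "(fst z, snd z) \<in> \<D>" "fst z \<in> N" using that by (auto simp: q_def)
          then have "snd z \<subseteq> \<gamma> (fst z)" using fine unfolding fine_def by blast
          then show ?thesis using \<open>fst z \<in> N\<close> by (simp add: \<gamma>_def)
        qed
        then show "\<Union>(snd ` q) \<subseteq> U" by (rule UN_least)
        show "\<Union>(snd ` q) \<in> sets lebesgue"
          using division_of_tagged_division[OF tq] lmeasurable_division by blast
      qed
      finally have small: "(\<Sum>(x, K)\<in>q. measure lborel K) < \<delta>" using U\<delta> by simp
      have 1: "(\<Sum>(x, K)\<in>q. \<bar>f (Sup K) - f (Inf K)\<bar>) < e / 2"
      proof (rule abs_continuous_sum_less[OF q(2) _ _ \<delta> small])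
        show "interior (snd y) \<inter> interior (snd z) = {}" if "y \<in> q" "z \<in> q" "y \<noteq> z" for y z
          using that tagged_division_ofD(5)[OF td, of "fst y" "snd y" "fst z" "snd z"] q(1) by auto
      qed (use lu q(1) in blast)+
      have 2: "(\<Sum>(x, K)\<in>\<D> - q. \<bar>measure lborel K * f' x - (f (Sup K) - f (Inf K))\<bar>) \<le> (\<Sum>(x, K)\<in>\<D> - q. e1 * measure lborel K)"
      proof (intro sum_mono, safe)
        fix x K assume xK: "(x, K) \<in> \<D>" "(x, K) \<notin> q"
        then obtain u v where K: "K = {u..v}" "u \<le> v" "a \<le> u" "v \<le> b" "x \<in> {u..v}"
          using lu by blast
        have x: "x \<in> {a..b} - N" using xK K by (auto simp: q_def)
        have "K \<subseteq> \<gamma> x" using fine xK by (auto simp: fine_def)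
        then have "K \<subseteq> ball x (d x)" using x by (simp add: \<gamma>_def)
        moreover have "u \<in> K" "v \<in> K" using K by auto
        ultimately have "u \<in> ball x (d x)" "v \<in> ball x (d x)" by blast+
        then have "\<bar>u - x\<bar> < d x" "\<bar>v - x\<bar> < d x" by (auto simp: dist_real_def)
        \<comment> \<open>Straddle estimate: the tag \<open>x\<close> lies between \<open>u\<close>
          and \<open>v\<close>, so the two errors at the endpoints add up to \<open>e1\<close> times
          the length of the cell.\<close>
        then have "\<bar>f u - f x - (u - x) * f' x\<bar> \<le> e1 * \<bar>u - x\<bar>"
          "\<bar>f v - f x - (v - x) * f' x\<bar> \<le> e1 * \<bar>v - x\<bar>"
          using d(2)[OF x, of u] d(2)[OF x, of v] K by simp_all
        moreover have "e1 * \<bar>u - x\<bar> + e1 * \<bar>v - x\<bar> = e1 * (v - u)"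
          using K by (auto simp: algebra_simps)
        moreover have "(v - u) * f' x - (f v - f u) =
            (f u - f x - (u - x) * f' x) - (f v - f x - (v - x) * f' x)"
          by (simp add: algebra_simps)
        ultimately have "\<bar>(v - u) * f' x - (f v - f u)\<bar> \<le> e1 * (v - u)" by linarith
        then show "\<bar>measure lborel K * f' x - (f (Sup K) - f (Inf K))\<bar> \<le> e1 * measure lborel K"
          using K by simp
      qed
      have "(\<Sum>(x, K)\<in>\<D> - q. e1 * measure lborel K) \<le> (\<Sum>(x, K)\<in>\<D>. e1 * measure lborel K)"
        using fin e1 by (intro sum_mono2) auto
      also have "\<dots> = e1 * (b - a)"
        using additive_content_tagged_division[of \<D> a b] td ab
        by (simp add: split_def flip: sum_distrib_left)
      also have "\<dots> < e / 2" using e ab by (simp add: e1_def field_simps)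
      finally have 3: "(\<Sum>(x, K)\<in>\<D> - q. e1 * measure lborel K) < e / 2" .
      have "(\<Sum>(x,k)\<in>\<D>. measure lborel k *\<^sub>R g x) - (f b - f a) =
          (\<Sum>(x,K)\<in>\<D>. measure lborel K * g x - (f (Sup K) - f (Inf K)))"
        using additive_tagged_division_1[OF ab td, of f] by (simp add: split_def sum_subtractf)
      also have "\<dots> = (\<Sum>(x,K)\<in>\<D> - q. measure lborel K * g x - (f (Sup K) - f (Inf K)))
           + (\<Sum>(x,K)\<in>q. measure lborel K * g x - (f (Sup K) - f (Inf K)))"
        by (rule sum.subset_diff[OF q(1) fin])
      finally have split: "(\<Sum>(x,k)\<in>\<D>. measure lborel k *\<^sub>R g x) - (f b - f a) =
          (\<Sum>(x,K)\<in>\<D> - q. measure lborel K * g x - (f (Sup K) - f (Inf K)))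
           + (\<Sum>(x,K)\<in>q. measure lborel K * g x - (f (Sup K) - f (Inf K)))" .
      have "\<bar>(\<Sum>(x,k)\<in>\<D>. measure lborel k *\<^sub>R g x) - (f b - f a)\<bar> \<le> (\<Sum>(x,K)\<in>\<D> - q. \<bar>measure lborel K * f' x - (f (Sup K) - f (Inf K))\<bar>)
           + (\<Sum>(x, K)\<in>q. \<bar>f (Sup K) - f (Inf K)\<bar>)"
      unfolding split
      proof (rule order_trans[OF abs_triangle_ineq], rule add_mono)
        show "\<bar>\<Sum>(x,K)\<in>\<D> - q. measure lborel K * g x - (f (Sup K) - f (Inf K))\<bar>
            \<le> (\<Sum>(x,K)\<in>\<D> - q. \<bar>measure lborel K * f' x - (f (Sup K) - f (Inf K))\<bar>)"
        proof (rule order_trans[OF sum_abs], rule sum_mono)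
          fix z assume "z \<in> \<D> - q"
          then show "\<bar>case z of (x, K) \<Rightarrow> measure lborel K * g x - (f (Sup K) - f (Inf K))\<bar>
            \<le> (case z of (x, K) \<Rightarrow> \<bar>measure lborel K * f' x - (f (Sup K) - f (Inf K))\<bar>)"
            by (cases z) (simp add: q_def g_def)
        qed
        \<comment> \<open>At tags in \<open>N\<close> the value \<open>g x\<close> is 0, so only an
          increment of \<open>f\<close> is left.\<close>
        show "\<bar>\<Sum>(x,K)\<in>q. measure lborel K * g x - (f (Sup K) - f (Inf K))\<bar>
            \<le> (\<Sum>(x,K)\<in>q. \<bar>f (Sup K) - f (Inf K)\<bar>)"
        proof (rule order_trans[OF sum_abs], rule sum_mono)
          fix z assume "z \<in> q"
          then show "\<bar>case z of (x, K) \<Rightarrow> measure lborel K * g x - (f (Sup K) - f (Inf K))\<bar>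
            \<le> (case z of (x, K) \<Rightarrow> \<bar>f (Sup K) - f (Inf K)\<bar>)"
            by (cases z) (simp add: q_def g_def abs_minus_commute)
        qed
      qed
      also have "\<dots> < e" using 1 2 3 by simp
      finally show ?thesis by simp
    qed
    ultimately show "\<exists>\<gamma>. gauge \<gamma> \<and> (\<forall>\<D>. \<D> tagged_division_of {a..b} \<and> \<gamma> fine \<D> \<longrightarrow>
        norm ((\<Sum>(x,k)\<in>\<D>. measure lborel k *\<^sub>R g x) - (f b - f a)) < e)" by (intro exI[of _ \<gamma>]) simp
  qed
  then show ?thesis
    by (rule has_integral_spike[OF N, rotated]) (auto simp: g_def)
qed

subsection \<open>Square-integrable functions on an interval\<close>

lemma sq_integrable_iff:
  "sq_integrable a b f \<longleftrightarrow> f \<in> borel_measurable (lebesgue_on {a..b}) \<and> integrable (lebesgue_on {a..b}) (\<lambda>t. (f t)\<^sup>2)"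
  unfolding sq_integrable_def set_borel_measurable_def set_integrable_def
  by (simp add: borel_measurable_restrict_space_iff integrable_restrict_space)

lemma set_lebesgue_integral_lebesgue_on:
  fixes f :: "real \<Rightarrow> real"
  shows "(LINT t:{a..b}|lebesgue. f t) = integral\<^sup>L (lebesgue_on {a..b}) f"
  unfolding set_lebesgue_integral_def by (simp add: integral_restrict_space)

lemma sq_integrable_measurable: "sq_integrable a b f \<Longrightarrow> f \<in> borel_measurable (lebesgue_on {a..b})"
  by (simp add: sq_integrable_iff)

lemma sq_integrable_mult:
  assumes f: "sq_integrable a b f" and g: "sq_integrable a b g"
  shows "integrable (lebesgue_on {a..b}) (\<lambda>t. f t * g t)"
proof (rule Bochner_Integration.integrable_bound)
  show "integrable (lebesgue_on {a..b}) (\<lambda>t. (f t)\<^sup>2 + (g t)\<^sup>2)"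
    using f g by (simp add: sq_integrable_iff)
  show "(\<lambda>t. f t * g t) \<in> borel_measurable (lebesgue_on {a..b})"
    using f g by (intro borel_measurable_times sq_integrable_measurable)
  have "norm (x * y) \<le> norm (x\<^sup>2 + y\<^sup>2)" for x y :: real
  proof -
    have "2 * (\<bar>x\<bar> * \<bar>y\<bar>) \<le> x\<^sup>2 + y\<^sup>2" using sum_squares_bound[of "\<bar>x\<bar>" "\<bar>y\<bar>"] by simp
    moreover have "0 \<le> \<bar>x\<bar> * \<bar>y\<bar>" by simp
    ultimately have "\<bar>x\<bar> * \<bar>y\<bar> \<le> x\<^sup>2 + y\<^sup>2" by linarith
    then show ?thesis by (simp add: abs_mult)
  qed
  then show "AE t in lebesgue_on {a..b}. norm (f t * g t) \<le> norm ((f t)\<^sup>2 + (g t)\<^sup>2)" by simp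
qed

lemma sq_integrable_bounded:
  assumes m: "f \<in> borel_measurable (lebesgue_on {a..b})" and bd: "\<And>t. t \<in> {a..b} \<Longrightarrow> \<bar>f t\<bar> \<le> B"
  shows "sq_integrable a b f"
  unfolding sq_integrable_iff
proof
  show "integrable (lebesgue_on {a..b}) (\<lambda>t. (f t)\<^sup>2)"
  proof (rule Bochner_Integration.integrable_bound)
    show "integrable (lebesgue_on {a..b}) (\<lambda>t. B\<^sup>2)"
      by (intro continuous_imp_integrable_real continuous_intros)
    show "(\<lambda>t. (f t)\<^sup>2) \<in> borel_measurable (lebesgue_on {a..b})" using m by simp
    have "(f t)\<^sup>2 \<le> B\<^sup>2" if "t \<in> {a..b}" for t
      using power_mono[OF bd[OF that], of 2] by simp
    then show "AE t in lebesgue_on {a..b}. norm ((f t)\<^sup>2) \<le> norm (B\<^sup>2)"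
      by (intro AE_I2) simp
  qed
qed fact

lemma continuous_on_Icc_bounded:
  fixes f :: "real \<Rightarrow> real"
  assumes "continuous_on {a..b} f"
  obtains B where "B > 0" "\<And>t. t \<in> {a..b} \<Longrightarrow> \<bar>f t\<bar> \<le> B"
proof -
  have "bounded (f ` {a..b})"
    by (intro compact_imp_bounded compact_continuous_image assms compact_Icc)
  then obtain B where "B > 0" "\<forall>y\<in>f ` {a..b}. norm y \<le> B" unfolding bounded_pos by blast
  then show thesis by (intro that[of B]) auto
qed

lemma continuous_sq_integrable:
  assumes "continuous_on {a..b} f"
  shows "sq_integrable a b f"
proof -
  obtain B where B: "\<And>t. t \<in> {a..b} \<Longrightarrow> \<bar>f t\<bar> \<le> B"
    using continuous_on_Icc_bounded[OF assms] by blast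
  show ?thesis
    by (rule sq_integrable_bounded[OF continuous_imp_measurable_on_sets_lebesgue[OF assms] B]) auto
qed

lemma sq_integrable_indicator:
  assumes "x \<in> {a..b}"
  shows "sq_integrable a b (indicator {a..x})"
proof (rule sq_integrable_bounded)
  have "{a..x} \<in> sets (lebesgue_on {a..b})" using assms by (simp add: sets_restrict_space_iff)
  then show "indicator {a..x} \<in> borel_measurable (lebesgue_on {a..b})" by (rule borel_measurable_indicator)
  show "\<bar>indicator {a..x} t\<bar> \<le> (1::real)" for t by (simp add: indicator_def)
qed

lemma sq_integrable_add:
  assumes f: "sq_integrable a b f" and g: "sq_integrable a b g"
  shows "sq_integrable a b (\<lambda>t. f t + g t)"
  unfolding sq_integrable_iff
proof
  have "integrable (lebesgue_on {a..b}) (\<lambda>t. (f t)\<^sup>2 + 2 * (f t * g t) + (g t)\<^sup>2)"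
    using f g sq_integrable_mult[OF f g] by (intro Bochner_Integration.integrable_add) (auto simp: sq_integrable_iff)
  then show "integrable (lebesgue_on {a..b}) (\<lambda>t. (f t + g t)\<^sup>2)"
    by (simp add: power2_sum algebra_simps)
  show "(\<lambda>t. f t + g t) \<in> borel_measurable (lebesgue_on {a..b})"
    using f g by (intro borel_measurable_add sq_integrable_measurable)
qed

lemma sq_integrable_continuous_mult:
  assumes q: "continuous_on {a..b} q" and f: "sq_integrable a b f"
  shows "sq_integrable a b (\<lambda>t. q t * f t)"
  unfolding sq_integrable_iff
proof
  obtain B where B: "\<And>t. t \<in> {a..b} \<Longrightarrow> \<bar>q t\<bar> \<le> B"
    using continuous_on_Icc_bounded[OF q] by blast
  show m: "(\<lambda>t. q t * f t) \<in> borel_measurable (lebesgue_on {a..b})"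
    using sq_integrable_measurable[OF continuous_sq_integrable[OF q]] sq_integrable_measurable[OF f]
    by (rule borel_measurable_times)
  show "integrable (lebesgue_on {a..b}) (\<lambda>t. (q t * f t)\<^sup>2)"
  proof (rule Bochner_Integration.integrable_bound)
    show "integrable (lebesgue_on {a..b}) (\<lambda>t. B\<^sup>2 * (f t)\<^sup>2)" using f by (simp add: sq_integrable_iff)
    show "(\<lambda>t. (q t * f t)\<^sup>2) \<in> borel_measurable (lebesgue_on {a..b})" using m by simp
    have "(q t * f t)\<^sup>2 \<le> B\<^sup>2 * (f t)\<^sup>2" if "t \<in> {a..b}" for t
      using power_mono[OF B[OF that], of 2] by (simp add: power_mult_distrib mult_right_mono)
    then show "AE t in lebesgue_on {a..b}. norm ((q t * f t)\<^sup>2) \<le> norm (B\<^sup>2 * (f t)\<^sup>2)"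
      by (intro AE_I2) simp
  qed
qed

text \<open>Needed because \<open>deriv\<close> is controlled only almost everywhere. Measurability
  passes to \<open>g\<close> by completeness of Lebesgue measure, after extension by 0 to the whole
  line.\<close>

lemma sq_integrable_cong_AE:
  assumes f: "sq_integrable a b f" and eq: "AE t in lebesgue_on {a..b}. g t = f t"
  shows "sq_integrable a b g"
proof -
  have "AE t in lebesgue. indicator {a..b} t *\<^sub>R f t = indicator {a..b} t *\<^sub>R g t"
    using eq by (simp add: AE_restrict_space_iff) (auto elim!: eventually_mono simp: indicator_def)
  from borel_measurable_AE[OF _ this] have "set_borel_measurable lebesgue {a..b} g"
    using f by (simp add: sq_integrable_def set_borel_measurable_def)
  then have m: "g \<in> borel_measurable (lebesgue_on {a..b})"
    by (simp add: set_borel_measurable_def borel_measurable_restrict_space_iff)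
  have "integrable (lebesgue_on {a..b}) (\<lambda>t. (f t)\<^sup>2) \<longleftrightarrow> integrable (lebesgue_on {a..b}) (\<lambda>t. (g t)\<^sup>2)"
    using eq m f by (intro integrable_cong_AE) (auto simp: sq_integrable_iff elim!: eventually_mono)
  with m f show ?thesis by (simp add: sq_integrable_iff)
qed

subsection \<open>The space \<open>H1\<close>\<close>

lemma abs_continuous_mono:
  assumes "abs_continuous a b f" "x \<le> b"
  shows "abs_continuous a x f"
  unfolding abs_continuous_def
proof (intro allI impI)
  fix \<epsilon> :: real assume "\<epsilon> > 0"
  from assms(1)[unfolded abs_continuous_def, rule_format, OF this] obtain \<delta> where "\<delta> > 0"
    and \<delta>: "\<And>(n::nat) l u. (\<forall>i<n. a \<le> l i \<and> l i \<le> u i \<and> u i \<le> b) \<Longrightarrow>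
        disjoint_family_on (\<lambda>i. {l i<..<u i}) {..<n} \<Longrightarrow>
        (\<Sum>i<n. u i - l i) < \<delta> \<Longrightarrow> (\<Sum>i<n. \<bar>f (u i) - f (l i)\<bar>) < \<epsilon>"
    by blast
  show "\<exists>\<delta>>0. \<forall>(n::nat) l u. (\<forall>i<n. a \<le> l i \<and> l i \<le> u i \<and> u i \<le> x) \<longrightarrow>
        disjoint_family_on (\<lambda>i. {l i<..<u i}) {..<n} \<longrightarrow>
        (\<Sum>i<n. u i - l i) < \<delta> \<longrightarrow> (\<Sum>i<n. \<bar>f (u i) - f (l i)\<bar>) < \<epsilon>"
  proof (intro exI[of _ \<delta>] conjI allI impI)
    fix n :: nat and l u :: "nat \<Rightarrow> real"
    assume lu: "\<forall>i<n. a \<le> l i \<and> l i \<le> u i \<and> u i \<le> x" "disjoint_family_on (\<lambda>i. {l i<..<u i}) {..<n}"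
      "(\<Sum>i<n. u i - l i) < \<delta>"
    have "\<forall>i<n. a \<le> l i \<and> l i \<le> u i \<and> u i \<le> b" using lu(1) \<open>x \<le> b\<close> by (meson order_trans)
    then show "(\<Sum>i<n. \<bar>f (u i) - f (l i)\<bar>) < \<epsilon>" using lu(2,3) by (rule \<delta>)
  qed fact
qed

lemma abs_continuous_imp_continuous_on:
  assumes "abs_continuous a b f"
  shows "continuous_on {a..b} f"
  unfolding continuous_on_iff
proof (intro ballI allI impI)
  fix x \<epsilon> :: real assume x: "x \<in> {a..b}" and "\<epsilon> > 0"
  from assms[unfolded abs_continuous_def, rule_format, OF \<open>\<epsilon> > 0\<close>] obtain \<delta> where "\<delta> > 0"
    and \<delta>: "\<And>(n::nat) l u. (\<forall>i<n. a \<le> l i \<and> l i \<le> u i \<and> u i \<le> b) \<Longrightarrow>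
        disjoint_family_on (\<lambda>i. {l i<..<u i}) {..<n} \<Longrightarrow>
        (\<Sum>i<n. u i - l i) < \<delta> \<Longrightarrow> (\<Sum>i<n. \<bar>f (u i) - f (l i)\<bar>) < \<epsilon>"
    by blast
  have "dist (f y) (f x) < \<epsilon>" if "y \<in> {a..b}" "dist y x < \<delta>" for y
    using \<delta>[of "Suc 0" "\<lambda>_. min x y" "\<lambda>_. max x y"] that x
    by (cases "x \<le> y") (auto simp: dist_real_def disjoint_family_on_def abs_minus_commute)
  then show "\<exists>\<delta>>0. \<forall>y\<in>{a..b}. dist y x < \<delta> \<longrightarrow> dist (f y) (f x) < \<epsilon>"
    using \<open>\<delta> > 0\<close> by blast
qed

text \<open>The lengths \<open>u - l\<close> are small in total as soon as they sum to less than
  \<open>\<delta>\<close>, so both halves of the bound are under control. With \<open>f\<close>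
  constant this covers Lipschitz functions, and with \<open>f = h\<close> products of
  \<open>h\<close> with a smooth factor.\<close>

lemma abs_continuous_dominated:
  assumes f: "abs_continuous a b f" and C: "C > 0"
    and dom: "\<And>l u. a \<le> l \<Longrightarrow> l \<le> u \<Longrightarrow> u \<le> b \<Longrightarrow> \<bar>g u - g l\<bar> \<le> C * (\<bar>f u - f l\<bar> + (u - l))"
  shows "abs_continuous a b g"
  unfolding abs_continuous_def
proof (intro allI impI)
  fix \<epsilon> :: real assume "\<epsilon> > 0"
  then have \<epsilon>: "\<epsilon> / (2 * C) > 0" using C by simp
  from f[unfolded abs_continuous_def, rule_format, OF this] obtain \<delta> where "\<delta> > 0"
    and \<delta>: "\<And>(n::nat) l u. (\<forall>i<n. a \<le> l i \<and> l i \<le> u i \<and> u i \<le> b) \<Longrightarrow>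
        disjoint_family_on (\<lambda>i. {l i<..<u i}) {..<n} \<Longrightarrow>
        (\<Sum>i<n. u i - l i) < \<delta> \<Longrightarrow> (\<Sum>i<n. \<bar>f (u i) - f (l i)\<bar>) < \<epsilon> / (2 * C)"
    by blast
  show "\<exists>\<delta>>0. \<forall>(n::nat) l u. (\<forall>i<n. a \<le> l i \<and> l i \<le> u i \<and> u i \<le> b) \<longrightarrow>
        disjoint_family_on (\<lambda>i. {l i<..<u i}) {..<n} \<longrightarrow>
        (\<Sum>i<n. u i - l i) < \<delta> \<longrightarrow> (\<Sum>i<n. \<bar>g (u i) - g (l i)\<bar>) < \<epsilon>"
  \<comment> \<open>The two entries of the minimum make the increments of \<open>f\<close> and the
    lengths each contribute less than \<open>\<epsilon> / (2 * C)\<close>.\<close>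
  proof (intro exI[of _ "min \<delta> (\<epsilon> / (2 * C))"] conjI allI impI)
    fix n :: nat and l u :: "nat \<Rightarrow> real"
    assume lu: "\<forall>i<n. a \<le> l i \<and> l i \<le> u i \<and> u i \<le> b" "disjoint_family_on (\<lambda>i. {l i<..<u i}) {..<n}"
      "(\<Sum>i<n. u i - l i) < min \<delta> (\<epsilon> / (2 * C))"
    have "(\<Sum>i<n. \<bar>g (u i) - g (l i)\<bar>) \<le> (\<Sum>i<n. C * (\<bar>f (u i) - f (l i)\<bar> + (u i - l i)))"
      using lu(1) by (intro sum_mono dom) auto
    also have "\<dots> = C * ((\<Sum>i<n. \<bar>f (u i) - f (l i)\<bar>) + (\<Sum>i<n. u i - l i))"
      by (simp only: sum_distrib_left[symmetric] sum.distrib)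
    also have "\<dots> < C * (\<epsilon> / (2 * C) + \<epsilon> / (2 * C))"
      using C \<delta>[OF lu(1,2)] lu(3) by (intro mult_strict_left_mono add_strict_mono) auto
    also have "\<dots> = \<epsilon>" using C by simp
    finally show "(\<Sum>i<n. \<bar>g (u i) - g (l i)\<bar>) < \<epsilon>" .
  qed (use \<open>\<delta> > 0\<close> \<epsilon> in auto)
qed

lemma abs_continuous_const: "abs_continuous a b (\<lambda>_. c)"
  unfolding abs_continuous_def by (auto intro: exI[of _ 1])

text \<open>The endpoints form a null set. This links the open interval in \<open>H1\<close>, where
  two-sided derivatives make sense, to integrals over \<open>{a..b}\<close>.\<close>

lemma AE_lebesgue_on_interior:
  "(AE t in lebesgue_on {a..b::real}. P t) \<longleftrightarrow> (AE t in lebesgue. t \<in> {a<..<b} \<longrightarrow> P t)"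
proof -
  have "{a, b} \<in> null_sets lebesgue" by simp
  then have ends: "AE t in lebesgue. t \<notin> {a, b}" by (rule AE_not_in)
  have "(AE t in lebesgue. t \<in> {a..b} \<longrightarrow> P t) \<longleftrightarrow> (AE t in lebesgue. t \<in> {a<..<b} \<longrightarrow> P t)"
  proof
    assume "AE t in lebesgue. t \<in> {a..b} \<longrightarrow> P t"
    then show "AE t in lebesgue. t \<in> {a<..<b} \<longrightarrow> P t" by eventually_elim auto
  next
    assume "AE t in lebesgue. t \<in> {a<..<b} \<longrightarrow> P t"
    with ends show "AE t in lebesgue. t \<in> {a..b} \<longrightarrow> P t" by eventually_elim (auto simp: less_le)
  qed
  then show ?thesis by (simp add: AE_restrict_space_iff)
qed

lemma H1_deriv: "h \<in> H1 a b \<Longrightarrow> AE t in lebesgue_on {a..b}. (h has_real_derivative deriv h t) (at t)"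
  unfolding AE_lebesgue_on_interior H1_def
  by (auto simp: DERIV_deriv_iff_real_differentiable elim!: eventually_mono)

lemma H1I:
  assumes ac: "abs_continuous a b h" and d: "AE t in lebesgue_on {a..b}. (h has_real_derivative g t) (at t)"
    and g: "sq_integrable a b g" and "h a = 0" "h b = 0"
  shows "h \<in> H1 a b" "AE t in lebesgue_on {a..b}. deriv h t = g t"
proof -
  show eq: "AE t in lebesgue_on {a..b}. deriv h t = g t"
    using d by (auto elim!: eventually_mono intro: DERIV_imp_deriv)
  have "AE t in lebesgue. t \<in> {a<..<b} \<longrightarrow> h differentiable (at t)"
    using d unfolding AE_lebesgue_on_interior
    by (auto elim!: eventually_mono simp: real_differentiable_def)
  then show "h \<in> H1 a b"
    using assms sq_integrable_cong_AE[OF g eq] continuous_sq_integrable[OF abs_continuous_imp_continuous_on[OF ac]]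
    unfolding H1_def by blast
qed

lemma H1_continuous: "h \<in> H1 a b \<Longrightarrow> continuous_on {a..b} h"
  by (auto simp: H1_def intro: abs_continuous_imp_continuous_on)

text \<open>The value at \<open>x\<close> is written as an \<open>L\<^sub>2\<close> product of the
  derivative with an indicator, the shape that Bessel's inequality needs; \<open>x = b\<close> also
  serves for integration by parts.\<close>

lemma H1_ftc:
  assumes h: "h \<in> H1 a b" and x: "x \<in> {a..b}"
  shows "integral\<^sup>L (lebesgue_on {a..b}) (\<lambda>t. indicator {a..x} t * deriv h t) = h x"
proof -
  define N where "N = {t. \<not> (t \<in> {a..b} \<longrightarrow> (h has_real_derivative deriv h t) (at t))}"
  have "AE t in lebesgue. t \<in> {a..b} \<longrightarrow> (h has_real_derivative deriv h t) (at t)"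
    using H1_deriv[OF h] by (simp add: AE_restrict_space_iff)
  then have "negligible N"
    by (simp add: N_def completion.AE_iff_null_sets negligible_iff_null_sets)
  have "(deriv h has_integral (h x - h a)) {a..x}"
  proof (rule abs_continuous_has_integral[OF _ abs_continuous_mono \<open>negligible N\<close>])
    show "(h has_real_derivative deriv h t) (at t within {a..x})" if "t \<in> {a..x} - N" for t
    proof (rule has_field_derivative_at_within)
      show "(h has_real_derivative deriv h t) (at t)" using that x by (auto simp: N_def)
    qed
  qed (use x h in \<open>auto simp: H1_def\<close>)
  then have 1: "((\<lambda>t. if t \<in> {a..x} then deriv h t else 0) has_integral h x) {a..b}"
    unfolding has_integral_restrict_Int using x h by (simp add: H1_def Int_absorb2)
  \<comment> \<open>A Lebesgue integrable function has the same gauge integral, so uniqueness of the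
    latter identifies the two values.\<close>
  have "integrable (lebesgue_on {a..b}) (\<lambda>t. indicator {a..x} t * deriv h t)"
    using h by (intro sq_integrable_mult sq_integrable_indicator x) (simp add: H1_def)
  from has_integral_integral_lebesgue_on[OF this]
  have "((\<lambda>t. if t \<in> {a..x} then deriv h t else 0) has_integral
     integral\<^sup>L (lebesgue_on {a..b}) (\<lambda>t. indicator {a..x} t * deriv h t)) {a..b}"
    by (simp add: indicator_times_eq_if)
  with 1 show ?thesis by (rule has_integral_unique[rotated])
qed

lemma C1_lipschitz:
  assumes q: "\<And>t. t \<in> {a..b} \<Longrightarrow> (q has_real_derivative q' t) (at t within {a..b})"
    and q': "continuous_on {a..b} q'"
  obtains B where "B > 0" "\<And>l u. a \<le> l \<Longrightarrow> l \<le> u \<Longrightarrow> u \<le> b \<Longrightarrow> \<bar>q u - q l\<bar> \<le> B * (u - l)"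
proof -
  obtain B where B: "B > 0" "\<And>t. t \<in> {a..b} \<Longrightarrow> \<bar>q' t\<bar> \<le> B"
    using continuous_on_Icc_bounded[OF q'] by blast
  have "norm (q u - q l) \<le> B * norm (u - l)" if "a \<le> l" "l \<le> u" "u \<le> b" for l u
    by (rule field_differentiable_bound[of "{a..b}" q q']) (use q B that in auto)
  then show thesis using B(1) by (intro that[of B]) auto
qed

lemma AE_has_real_derivative_at:
  assumes "\<And>t. t \<in> {a..b} \<Longrightarrow> (q has_real_derivative q' t) (at t within {a..b})"
  shows "AE t in lebesgue_on {a..b}. (q has_real_derivative q' t) (at t)"
  unfolding AE_lebesgue_on_interior
proof (intro always_eventually allI impI)
  fix t assume "t \<in> {a<..<b}"
  with assms[of t] show "(q has_real_derivative q' t) (at t)" by (simp add: at_within_Icc_at)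
qed

lemma H1_C1:
  assumes q: "\<And>t. t \<in> {a..b} \<Longrightarrow> (q has_real_derivative q' t) (at t within {a..b})"
    and q': "continuous_on {a..b} q'" and 0: "q a = 0" "q b = 0"
  shows "q \<in> H1 a b" "AE t in lebesgue_on {a..b}. deriv q t = q' t"
proof -
  obtain B where B: "B > 0" "\<And>l u. a \<le> l \<Longrightarrow> l \<le> u \<Longrightarrow> u \<le> b \<Longrightarrow> \<bar>q u - q l\<bar> \<le> B * (u - l)"
    using C1_lipschitz[OF q q'] by blast
  have "abs_continuous a b q"
    \<comment> \<open>The dominating function is constant, so the bound reduces to the Lipschitz
      condition.\<close>
    by (rule abs_continuous_dominated[OF abs_continuous_const B(1)]) (use B(2) in auto)
  moreover have "AE t in lebesgue_on {a..b}. (q has_real_derivative q' t) (at t)"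
    using q by (rule AE_has_real_derivative_at)
  ultimately show "q \<in> H1 a b" "AE t in lebesgue_on {a..b}. deriv q t = q' t"
    using H1I[of a b q q'] continuous_sq_integrable[OF q'] 0 by blast+
qed

text \<open>Serves twice: with \<open>1 / p\<close> to pass from \<open>e\<close> to
  \<open>u\<close>, and with \<open>osc_cos s\<close> to integrate by parts against a test
  function.\<close>

lemma H1_mult_C1:
  assumes h: "h \<in> H1 a b" and q: "\<And>t. t \<in> {a..b} \<Longrightarrow> (q has_real_derivative q' t) (at t within {a..b})"
    and q': "continuous_on {a..b} q'"
  shows "(\<lambda>t. q t * h t) \<in> H1 a b"
    "AE t in lebesgue_on {a..b}. deriv (\<lambda>t. q t * h t) t = q' t * h t + q t * deriv h t"
proof -
  have qc: "continuous_on {a..b} q" using q by (rule DERIV_continuous_on)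
  obtain B where B: "B > 0" "\<And>l u. a \<le> l \<Longrightarrow> l \<le> u \<Longrightarrow> u \<le> b \<Longrightarrow> \<bar>q u - q l\<bar> \<le> B * (u - l)"
    using C1_lipschitz[OF q q'] by blast
  obtain Q where Q: "Q > 0" "\<And>t. t \<in> {a..b} \<Longrightarrow> \<bar>q t\<bar> \<le> Q"
    using continuous_on_Icc_bounded[OF qc] by blast
  obtain H where H: "H > 0" "\<And>t. t \<in> {a..b} \<Longrightarrow> \<bar>h t\<bar> \<le> H"
    using continuous_on_Icc_bounded[OF H1_continuous[OF h]] by blast
  have "abs_continuous a b (\<lambda>t. q t * h t)"
  proof (rule abs_continuous_dominated)
    show "abs_continuous a b h" using h by (simp add: H1_def)
    show "Q + H * B > 0" using Q H B by (simp add: add_pos_pos)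
    fix l u assume lu: "a \<le> l" "l \<le> u" "u \<le> b"
    have "\<bar>q u * h u - q l * h l\<bar> = \<bar>q u * (h u - h l) + h l * (q u - q l)\<bar>"
      by (simp add: algebra_simps)
    also have "\<dots> \<le> \<bar>q u\<bar> * \<bar>h u - h l\<bar> + \<bar>h l\<bar> * \<bar>q u - q l\<bar>"
      by (metis abs_triangle_ineq abs_mult)
    also have "\<dots> \<le> Q * \<bar>h u - h l\<bar> + H * (B * (u - l))"
      using Q H lu B by (intro add_mono mult_mono) auto
    \<comment> \<open>Adding the nonnegative cross terms makes the bound factor as a single constant
      times the sum of increment and length.\<close>
    also have "\<dots> \<le> Q * \<bar>h u - h l\<bar> + H * (B * (u - l)) + (Q * (u - l) + H * B * \<bar>h u - h l\<bar>)"
      using Q H B lu by simp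
    also have "\<dots> = (Q + H * B) * (\<bar>h u - h l\<bar> + (u - l))"
      by (simp add: algebra_simps)
    finally show "\<bar>q u * h u - q l * h l\<bar> \<le> (Q + H * B) * (\<bar>h u - h l\<bar> + (u - l))" .
  qed
  moreover have "AE t in lebesgue_on {a..b}. ((\<lambda>t. q t * h t) has_real_derivative (q' t * h t + q t * deriv h t)) (at t)"
  proof -
    have "AE t in lebesgue_on {a..b}. (q has_real_derivative q' t) (at t)"
      using q by (rule AE_has_real_derivative_at)
    with H1_deriv[OF h] show ?thesis
      by eventually_elim (auto intro!: derivative_eq_intros)
  qed
  moreover have "sq_integrable a b (\<lambda>t. q' t * h t + q t * deriv h t)"
    using h by (intro sq_integrable_add sq_integrable_continuous_mult qc q') (auto simp: H1_def)
  ultimately show "(\<lambda>t. q t * h t) \<in> H1 a b"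
    "AE t in lebesgue_on {a..b}. deriv (\<lambda>t. q t * h t) t = q' t * h t + q t * deriv h t"
    using H1I[of a b "\<lambda>t. q t * h t"] h by (auto simp: H1_def)
qed

subsection \<open>Bessel inequality\<close>

text \<open>Expand the integral of the squared residual of \<open>g\<close> after subtracting its
  projection. The \<open>v i\<close> are not normalised, hence the division by their squared
  norms.\<close>

lemma bessel_inequality:
  fixes g :: "'a \<Rightarrow> real" and v :: "'i \<Rightarrow> 'a \<Rightarrow> real"
  assumes F: "finite F" and gg: "integrable M (\<lambda>x. g x * g x)"
    and gv: "\<And>i. i \<in> F \<Longrightarrow> integrable M (\<lambda>x. g x * v i x)"
    and vv: "\<And>i j. i \<in> F \<Longrightarrow> j \<in> F \<Longrightarrow> integrable M (\<lambda>x. v i x * v j x)"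
    and orth: "\<And>i j. i \<in> F \<Longrightarrow> j \<in> F \<Longrightarrow> i \<noteq> j \<Longrightarrow> (\<integral>x. v i x * v j x \<partial>M) = 0"
  shows "(\<Sum>i\<in>F. (\<integral>x. g x * v i x \<partial>M)\<^sup>2 / (\<integral>x. v i x * v i x \<partial>M)) \<le> (\<integral>x. g x * g x \<partial>M)"
proof -
  define G where "G i = (\<integral>x. g x * v i x \<partial>M)" for i
  define N where "N i = (\<integral>x. v i x * v i x \<partial>M)" for i
  \<comment> \<open>The Fourier coefficient; it is 0 when \<open>N i = 0\<close>, since division by
    zero gives 0, and the identities below remain true.\<close>
  define c where "c i = G i / N i" for i
  have eq: "(g x - (\<Sum>i\<in>F. c i * v i x))\<^sup>2 = g x * g x - 2 * (\<Sum>i\<in>F. c i * (g x * v i x))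
      + (\<Sum>i\<in>F. \<Sum>j\<in>F. c i * c j * (v i x * v j x))" for x
    by (simp add: power2_diff power2_eq_square sum_product sum_distrib_left algebra_simps)
  have "0 \<le> (\<integral>x. (g x - (\<Sum>i\<in>F. c i * v i x))\<^sup>2 \<partial>M)" by simp
  also have "\<dots> = (\<integral>x. g x * g x \<partial>M) - 2 * (\<Sum>i\<in>F. c i * G i)
      + (\<Sum>i\<in>F. \<Sum>j\<in>F. c i * c j * (\<integral>x. v i x * v j x \<partial>M))"
    unfolding eq using gg gv vv by (simp add: G_def)
  also have "(\<Sum>i\<in>F. \<Sum>j\<in>F. c i * c j * (\<integral>x. v i x * v j x \<partial>M)) = (\<Sum>i\<in>F. c i * c i * N i)"
  proof (intro sum.cong refl)
    fix i assume i: "i \<in> F"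
    have "(\<Sum>j\<in>F. c i * c j * (\<integral>x. v i x * v j x \<partial>M)) = (\<Sum>j\<in>F. if j = i then c i * c i * N i else 0)"
      using i orth by (intro sum.cong) (auto simp: N_def)
    then show "(\<Sum>j\<in>F. c i * c j * (\<integral>x. v i x * v j x \<partial>M)) = c i * c i * N i"
      using i F by simp
  qed
  also have "\<dots> = (\<Sum>i\<in>F. (G i)\<^sup>2 / N i)"
    by (intro sum.cong) (auto simp: c_def power2_eq_square)
  also have "(\<Sum>i\<in>F. c i * G i) = (\<Sum>i\<in>F. (G i)\<^sup>2 / N i)"
    by (intro sum.cong) (auto simp: c_def power2_eq_square)
  finally show ?thesis by (simp add: G_def N_def)
qed

text \<open>Bessel's inequality bounds all finite partial sums of \<open>\<phi>\<close> by the
  squared norm of \<open>g\<close>, and a summable family of reals has countable support.\<close>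

lemma countable_nonorthogonal:
  fixes g :: "'a \<Rightarrow> real" and v :: "'i \<Rightarrow> 'a \<Rightarrow> real"
  assumes gg: "integrable M (\<lambda>x. g x * g x)"
    and gv: "\<And>i. i \<in> I \<Longrightarrow> integrable M (\<lambda>x. g x * v i x)"
    and vv: "\<And>i j. i \<in> I \<Longrightarrow> j \<in> I \<Longrightarrow> integrable M (\<lambda>x. v i x * v j x)"
    and orth: "\<And>i j. i \<in> I \<Longrightarrow> j \<in> I \<Longrightarrow> i \<noteq> j \<Longrightarrow> (\<integral>x. v i x * v j x \<partial>M) = 0"
  shows "countable {i \<in> I. (\<integral>x. g x * v i x \<partial>M) \<noteq> 0}"
proof -
  define \<phi> where "\<phi> i = (\<integral>x. g x * v i x \<partial>M)\<^sup>2 / (\<integral>x. v i x * v i x \<partial>M)" for i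
  have "\<phi> summable_on I"
  proof (rule nonneg_bounded_partial_sums_imp_summable_on)
    show "0 \<le> \<phi> i" for i by (simp add: \<phi>_def)
    have "sum \<phi> F \<le> (\<integral>x. g x * g x \<partial>M)" if "finite F" "F \<subseteq> I" for F
      unfolding \<phi>_def using that by (intro bessel_inequality gg gv vv orth) auto
    then show "eventually (\<lambda>F. sum \<phi> F \<le> (\<integral>x. g x * g x \<partial>M)) (finite_subsets_at_top I)"
      by (intro eventually_finite_subsets_at_top_weakI)
  qed
  then have "countable {i \<in> I. \<phi> i \<noteq> 0}" by (rule summable_countable_real)
  moreover have "{i \<in> I. (\<integral>x. g x * v i x \<partial>M) \<noteq> 0} \<subseteq> {i \<in> I. \<phi> i \<noteq> 0}"
  \<comment> \<open>\<open>\<phi> i\<close> could also vanish through a zero denominator; then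
    \<open>v i\<close> is 0 almost everywhere, and so its product with \<open>g\<close> integrates
    to 0.\<close>
  proof (clarify)
    fix i assume i: "i \<in> I" "(\<integral>x. g x * v i x \<partial>M) \<noteq> 0" "\<phi> i = 0"
    then have "(\<integral>x. v i x * v i x \<partial>M) = 0" by (simp add: \<phi>_def)
    then have "AE x in M. v i x * v i x = 0"
      using integral_nonneg_eq_0_iff_AE[OF vv[OF i(1) i(1)]] by simp
    then have "AE x in M. g x * v i x = 0" by eventually_elim simp
    then have "(\<integral>x. g x * v i x \<partial>M) = 0" by (rule integral_eq_zero_AE)
    with i(2) show False ..
  qed
  ultimately show ?thesis by (rule countable_subset[rotated])
qed

subsection \<open>Oscillation of the Sturm--Liouville equation\<close>

text \<open>
  The assumption on \<open>\<theta>'\<close> says that \<open>\<theta>\<close> is the Pruefer angle of \<open>A + i B\<close>; the square of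
  \<open>A sin \<theta> - B cos \<theta>\<close> divided by \<open>A^2 + B^2\<close> then has derivative zero.
\<close>

lemma phase_relation:
  fixes A B \<theta> A' B' \<theta>' :: "real \<Rightarrow> real"
  assumes A: "\<And>t. t \<in> {a..b} \<Longrightarrow> (A has_real_derivative A' t) (at t within {a..b})"
    and B: "\<And>t. t \<in> {a..b} \<Longrightarrow> (B has_real_derivative B' t) (at t within {a..b})"
    and \<theta>: "\<And>t. t \<in> {a..b} \<Longrightarrow> (\<theta> has_real_derivative \<theta>' t) (at t within {a..b})"
    and nz: "\<And>t. t \<in> {a..b} \<Longrightarrow> (A t)\<^sup>2 + (B t)\<^sup>2 > 0"
    and \<theta>': "\<And>t. t \<in> {a..b} \<Longrightarrow> \<theta>' t * ((A t)\<^sup>2 + (B t)\<^sup>2) = A t * B' t - B t * A' t"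
    and init: "\<theta> a = 0" "B a = 0" and t: "t \<in> {a..b}"
  shows "A t * sin (\<theta> t) = B t * cos (\<theta> t)"
proof -
  define y where "y t = A t * sin (\<theta> t) - B t * cos (\<theta> t)" for t
  define y' where "y' t = (A' t + B t * \<theta>' t) * sin (\<theta> t) + (A t * \<theta>' t - B' t) * cos (\<theta> t)" for t
  define R where "R t = (A t)\<^sup>2 + (B t)\<^sup>2" for t
  have "((\<lambda>t. (y t)\<^sup>2 / R t) has_real_derivative 0) (at t within {a..b})" if t: "t \<in> {a..b}" for t
  proof -
    have y: "(y has_real_derivative y' t) (at t within {a..b})"
      unfolding y_def y'_def
      by (auto intro!: derivative_eq_intros A[OF t] B[OF t] \<theta>[OF t] simp: algebra_simps)
    have R: "(R has_real_derivative 2 * (A t * A' t + B t * B' t)) (at t within {a..b})"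
      unfolding R_def by (auto intro!: derivative_eq_intros A[OF t] B[OF t] simp: algebra_simps)
    \<comment> \<open>Multiplying by \<open>R t\<close> lets the assumption eliminate
      \<open>\<theta>' t\<close>. The outcome says that \<open>y' R\<close> is \<open>y\<close>
      times half the derivative of \<open>R\<close>, so the numerator of the quotient rule
      vanishes.\<close>
    have "y' t * R t = (A' t * R t + B t * (\<theta>' t * R t)) * sin (\<theta> t) + (A t * (\<theta>' t * R t) - B' t * R t) * cos (\<theta> t)"
      unfolding y'_def by algebra
    also have "\<dots> = y t * (A t * A' t + B t * B' t)"
      using \<theta>'[OF t] unfolding R_def y_def by algebra
    finally have "2 * (y t * y' t) * R t - (y t)\<^sup>2 * (2 * (A t * A' t + B t * B' t)) = 0"
      by algebra
    then have "(2 * (y t * y' t) * R t - (y t)\<^sup>2 * (2 * (A t * A' t + B t * B' t))) / (R t * R t) = 0"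
      by simp
    moreover have dy2: "((\<lambda>t. (y t)\<^sup>2) has_real_derivative 2 * (y t * y' t)) (at t within {a..b})"
      by (auto intro!: derivative_eq_intros y)
    have "R t \<noteq> 0" using nz[OF t] unfolding R_def by linarith
    from DERIV_divide[OF dy2 R this] have "((\<lambda>t. (y t)\<^sup>2 / R t) has_real_derivative
        (2 * (y t * y' t) * R t - (y t)\<^sup>2 * (2 * (A t * A' t + B t * B' t))) / (R t * R t)) (at t within {a..b})" .
    ultimately show ?thesis by metis
  qed
  then have "\<exists>c. \<forall>t\<in>{a..b}. (y t)\<^sup>2 / R t = c"
    by (intro has_field_derivative_zero_constant) auto
  then obtain c where c: "\<And>t. t \<in> {a..b} \<Longrightarrow> (y t)\<^sup>2 / R t = c" by blast
  have "a \<in> {a..b}" using t by auto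
  from c[OF this] have "c = 0" by (simp add: y_def init)
  with c[OF t] nz[OF t] show ?thesis by (auto simp: R_def y_def)
qed

locale sturm_liouville =
  fixes a b :: real and p :: "real \<Rightarrow> real"
  assumes ab: "a < b" and p_cont: "continuous_on {a..b} p"
    and p_pos: "\<And>t. t \<in> {a..b} \<Longrightarrow> p t > 0"
begin

section \<open>Iterated integrals with alternating weights\<close>

definition weight :: "nat \<Rightarrow> real \<Rightarrow> real" where
  "weight n t = (if even n then 1 / p t else p t)"

text \<open>The Picard iterates of the system for \<open>A\<close> and \<open>B\<close>:
  \<open>B\<close> is an integral of \<open>A / p\<close> and \<open>A\<close> one of
  \<open>p B\<close>, so the weight alternates. Index 0 belongs to \<open>A\<close>, hence
  \<open>1 / p\<close> at even steps.\<close>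

primrec iter_int :: "nat \<Rightarrow> real \<Rightarrow> real" where
  "iter_int 0 = (\<lambda>t. 1)"
| "iter_int (Suc n) = (\<lambda>t. integral {a..t} (\<lambda>x. weight n x * iter_int n x))"

definition K :: real where "K = (SOME K. K > 0 \<and> (\<forall>t\<in>{a..b}. p t \<le> K \<and> 1 / p t \<le> K))"

lemma recip_cont: "continuous_on {a..b} (\<lambda>t. 1 / p t)"
  by (intro continuous_intros p_cont) (use p_pos in fastforce)

lemma K: "K > 0" "\<And>t. t \<in> {a..b} \<Longrightarrow> p t \<le> K" "\<And>t. t \<in> {a..b} \<Longrightarrow> 1 / p t \<le> K"
proof -
  obtain K1 where K1: "K1 > 0" "\<And>t. t \<in> {a..b} \<Longrightarrow> \<bar>p t\<bar> \<le> K1"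
    using continuous_on_Icc_bounded[OF p_cont] by blast
  obtain K2 where K2: "\<And>t. t \<in> {a..b} \<Longrightarrow> \<bar>1 / p t\<bar> \<le> K2"
    using continuous_on_Icc_bounded[OF recip_cont] by blast
  have "p t \<le> max K1 K2 \<and> 1 / p t \<le> max K1 K2" if "t \<in> {a..b}" for t
  proof -
    have "\<bar>p t\<bar> \<le> K1" "\<bar>1 / p t\<bar> \<le> K2" using K1(2) K2 that by blast+
    then show ?thesis by linarith
  qed
  then have "\<exists>K>0. \<forall>t\<in>{a..b}. p t \<le> K \<and> 1 / p t \<le> K"
    using K1(1) by (intro exI[of _ "max K1 K2"]) auto
  from someI_ex[OF this] have "K > 0 \<and> (\<forall>t\<in>{a..b}. p t \<le> K \<and> 1 / p t \<le> K)"
    unfolding K_def .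
  then show "K > 0" "\<And>t. t \<in> {a..b} \<Longrightarrow> p t \<le> K" "\<And>t. t \<in> {a..b} \<Longrightarrow> 1 / p t \<le> K"
    by blast+
qed

lemma weight_cont: "continuous_on {a..b} (weight n)"
  unfolding weight_def[abs_def] using p_cont recip_cont by (cases "even n") auto

lemma weight_bound: "t \<in> {a..b} \<Longrightarrow> \<bar>weight n t\<bar> \<le> K"
  using K p_pos[of t] by (auto simp: weight_def)

lemma iter_int_cont: "continuous_on {a..b} (iter_int n)"
proof (induction n)
  case (Suc n)
  then have "continuous_on {a..b} (\<lambda>x. weight n x * iter_int n x)"
    by (intro continuous_intros weight_cont)
  then show ?case
    using indefinite_integral_continuous_1[OF integrable_continuous_real] by simp
qed simp

lemma iter_int_deriv:
  assumes "t \<in> {a..b}"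
  shows "(iter_int (Suc n) has_real_derivative weight n t * iter_int n t) (at t within {a..b})"
  unfolding iter_int.simps
  by (intro integral_has_real_derivative continuous_intros weight_cont iter_int_cont assms)

text \<open>The bound is itself the iterated integral for the constant weight \<open>K\<close>,
  which dominates both weights.\<close>

lemma iter_int_bound: "t \<in> {a..b} \<Longrightarrow> \<bar>iter_int n t\<bar> \<le> (K * (t - a)) ^ n / fact n"
proof (induction n arbitrary: t)
  case (Suc n)
  have "((\<lambda>x. (K * (x - a)) ^ Suc n / fact (Suc n)) has_vector_derivative K * ((K * (x - a)) ^ n / fact n)) (at x within {a..t})" for x
    unfolding has_real_derivative_iff_has_vector_derivative[symmetric]
    by (rule derivative_eq_intros refl | simp)+
  then have I: "((\<lambda>x. K * ((K * (x - a)) ^ n / fact n)) has_integral (K * (t - a)) ^ Suc n / fact (Suc n)) {a..t}"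
    using fundamental_theorem_of_calculus[of a t "\<lambda>x. (K * (x - a)) ^ Suc n / fact (Suc n)"] Suc.prems
    by simp
  have sub: "{a..t} \<subseteq> {a..b}" using Suc.prems by auto
  have "norm (integral {a..t} (\<lambda>x. weight n x * iter_int n x)) \<le> integral {a..t} (\<lambda>x. K * ((K * (x - a)) ^ n / fact n))"
  proof (rule integral_norm_bound_integral)
    show "(\<lambda>x. weight n x * iter_int n x) integrable_on {a..t}"
      by (intro integrable_continuous_real continuous_on_mult continuous_on_subset[OF weight_cont sub]
          continuous_on_subset[OF iter_int_cont sub])
    show "(\<lambda>x. K * ((K * (x - a)) ^ n / fact n)) integrable_on {a..t}" using I by blast
    show "norm (weight n x * iter_int n x) \<le> K * ((K * (x - a)) ^ n / fact n)" if "x \<in> {a..t}" for x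
      using that sub Suc.IH[of x] weight_bound[of x n] K(1)
      by (simp only: real_norm_def abs_mult) (intro mult_mono, auto)
  qed
  then show ?case unfolding integral_unique[OF I] by simp
qed simp

text \<open>
  The system \<open>A' = - s p B\<close>, \<open>B' = s A / p\<close>, \<open>A a = 1\<close>, \<open>B a = 0\<close> is solved by
  \<open>A + i B = (\<Sum>n. (i s)^n F n)\<close>, where \<open>F = iter_int\<close>; \<open>cos_sign\<close> and \<open>sin_sign\<close> are the real and
  imaginary parts of \<open>i^n\<close>.
\<close>

definition osc_series :: "(nat \<Rightarrow> real) \<Rightarrow> real \<Rightarrow> real \<Rightarrow> real" where
  "osc_series c s t = (\<Sum>n. c n * s ^ n * iter_int n t)"

text \<open>The majorant depends on neither \<open>s\<close> nor \<open>t\<close> and is a term of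
  an exponential series. The Weierstrass test then gives continuity jointly in \<open>s\<close> and
  \<open>t\<close>, on which continuity of the angle in \<open>s\<close> rests.\<close>

lemma osc_term_bound:
  assumes c: "\<And>n. \<bar>c n\<bar> \<le> 1" and s: "0 \<le> s" "s \<le> S" and t: "t \<in> {a..b}"
  shows "norm (c n * s ^ n * iter_int n t) \<le> (S * K * (b - a)) ^ n / fact n"
proof -
  have "\<bar>iter_int n t\<bar> \<le> (K * (t - a)) ^ n / fact n" by (rule iter_int_bound[OF t])
  also have "\<dots> \<le> (K * (b - a)) ^ n / fact n"
    using t K(1) by (intro divide_right_mono power_mono mult_left_mono) auto
  finally have "\<bar>c n\<bar> * s ^ n * \<bar>iter_int n t\<bar> \<le> 1 * S ^ n * ((K * (b - a)) ^ n / fact n)"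
    using c s by (intro mult_mono power_mono) auto
  then show ?thesis using s by (simp add: abs_mult power_mult_distrib mult.assoc)
qed

lemma osc_summable_bound: "summable (\<lambda>n. (S * K * (b - a)) ^ n / fact n)"
  using summable_exp[of "S * K * (b - a)"] by (simp add: field_simps)

lemma osc_series_summable:
  assumes "\<And>n. \<bar>c n\<bar> \<le> 1" "0 \<le> s" "t \<in> {a..b}"
  shows "summable (\<lambda>n. c n * s ^ n * iter_int n t)"
  by (rule summable_comparison_test'[OF osc_summable_bound[of s] osc_term_bound]) (use assms in auto)

lemma osc_series_cont:
  assumes "\<And>n. \<bar>c n\<bar> \<le> 1"
  shows "continuous_on ({0..S} \<times> {a..b}) (\<lambda>(s, t). osc_series c s t)"
proof -
  have "uniform_limit ({0..S} \<times> {a..b}) (\<lambda>n x. \<Sum>i<n. c i * fst x ^ i * iter_int i (snd x))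
     (\<lambda>x. \<Sum>i. c i * fst x ^ i * iter_int i (snd x)) sequentially"
  proof (rule Weierstrass_m_test[OF _ osc_summable_bound[of S]])
    fix n x assume "x \<in> {0..S} \<times> {a..b}"
    then show "norm (c n * fst x ^ n * iter_int n (snd x)) \<le> (S * K * (b - a)) ^ n / fact n"
      by (intro osc_term_bound assms) auto
  qed
  then have "continuous_on ({0..S} \<times> {a..b}) (\<lambda>x. \<Sum>i. c i * fst x ^ i * iter_int i (snd x))"
    by (rule uniform_limit_theorem[rotated])
      (auto intro!: always_eventually continuous_intros continuous_on_compose2[OF iter_int_cont])
  then show ?thesis by (simp add: osc_series_def split_def)
qed

lemma osc_series_deriv:
  assumes c: "\<And>n. \<bar>c n\<bar> \<le> 1" and s: "0 \<le> s" and t: "t \<in> {a..b}"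
  shows "(osc_series c s has_real_derivative (\<Sum>n. c (Suc n) * s ^ Suc n * (weight n t * iter_int n t))) (at t within {a..b})"
proof -
  define f where "f n t = c n * s ^ n * iter_int n t" for n t
  \<comment> \<open>Term 0 of the series is constant in \<open>t\<close>. In the others one
    integration is undone, so the majorant \<open>M\<close> is the shifted exponential series with a
    factor \<open>s\<close> from the extra power and \<open>K\<close> from the weight.\<close>
  define f' where "f' n t = (case n of 0 \<Rightarrow> 0 | Suc m \<Rightarrow> c (Suc m) * s ^ Suc m * (weight m t * iter_int m t))" for n t
  define M where "M n = (case n of 0 \<Rightarrow> 0 | Suc m \<Rightarrow> (s * K) * ((s * K * (b - a)) ^ m / fact m))" for n
  have f': "(f n has_real_derivative f' n x) (at x within {a..b})" if "x \<in> {a..b}" for n x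
    unfolding f_def f'_def
    by (cases n) (auto intro!: DERIV_cmult iter_int_deriv[unfolded iter_int.simps] that derivative_eq_intros split: nat.split)
  have bound: "norm (f' n x) \<le> M n" if x: "x \<in> {a..b}" for n x
  proof (cases n)
    case (Suc m)
    have "\<bar>weight m x\<bar> * \<bar>c (Suc m) * s ^ m * iter_int m x\<bar> \<le> K * ((s * K * (b - a)) ^ m / fact m)"
      using weight_bound[OF x, of m] osc_term_bound[of "\<lambda>n. c (Suc n)" s s x m] c s x K(1)
      by (intro mult_mono) auto
    then have "s * (\<bar>weight m x\<bar> * \<bar>c (Suc m) * s ^ m * iter_int m x\<bar>) \<le> s * (K * ((s * K * (b - a)) ^ m / fact m))"
      using s by (rule mult_left_mono)
    then show ?thesis using s by (simp add: Suc f'_def M_def abs_mult mult_ac)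
  qed (simp add: f'_def M_def)
  have "summable M"
    using summable_mult[OF osc_summable_bound[of s], of "s * K"]
    by (subst summable_Suc_iff[symmetric]) (simp add: M_def)
  then have "uniform_limit {a..b} (\<lambda>n x. \<Sum>i<n. f' i x) (\<lambda>x. \<Sum>i. f' i x) sequentially"
    by (intro Weierstrass_m_test[OF bound])
  moreover have "summable (\<lambda>n. f n t)"
    unfolding f_def by (rule osc_series_summable[OF c s t])
  ultimately obtain g where g: "\<forall>x\<in>{a..b}. (\<lambda>n. f n x) sums g x \<and>
      (g has_real_derivative (\<Sum>i. f' i x)) (at x within {a..b})"
    using has_field_derivative_series[where f = f and f' = f', OF convex_real_interval(5) f' _ t] by blast
  have "summable (\<lambda>n. f' n t)"
    by (rule summable_comparison_test'[OF \<open>summable M\<close> bound[OF t]])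
  moreover have "f' 0 t = 0" by (simp add: f'_def)
  ultimately have eq: "(\<Sum>i. f' i t) = (\<Sum>n. f' (Suc n) t)"
    using suminf_split_head[of "\<lambda>n. f' n t"] by simp
  have "(g has_real_derivative (\<Sum>n. f' (Suc n) t)) (at t within {a..b})"
    unfolding eq[symmetric] using g t by blast
  then have "(osc_series c s has_real_derivative (\<Sum>n. f' (Suc n) t)) (at t within {a..b})"
  proof (rule has_field_derivative_transform_within[OF _ zero_less_one t])
    show "g x = osc_series c s x" if "x \<in> {a..b}" for x
      using g that by (auto simp: osc_series_def f_def sums_iff)
  qed
  then show ?thesis by (simp add: f'_def)
qed

section \<open>The two components of the solution\<close>

definition cos_sign :: "nat \<Rightarrow> real" where
  "cos_sign n = (if even n then (- 1) ^ (n div 2) else 0)"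

definition sin_sign :: "nat \<Rightarrow> real" where
  "sin_sign n = (if odd n then (- 1) ^ (n div 2) else 0)"

lemma sign_Suc: "cos_sign (Suc n) = - sin_sign n" "sin_sign (Suc n) = cos_sign n"
  by (auto simp: cos_sign_def sin_sign_def elim!: oddE)

lemma sign_bound: "\<bar>cos_sign n\<bar> \<le> 1" "\<bar>sin_sign n\<bar> \<le> 1"
  by (auto simp: cos_sign_def sin_sign_def power_abs)

abbreviation "osc_cos \<equiv> osc_series cos_sign"
abbreviation "osc_sin \<equiv> osc_series sin_sign"

lemma osc_cos_deriv:
  assumes s: "0 \<le> s" and t: "t \<in> {a..b}"
  shows "(osc_cos s has_real_derivative - (s * p t * osc_sin s t)) (at t within {a..b})"
proof -
  \<comment> \<open>\<open>sin_sign n\<close> is nonzero only for odd \<open>n\<close>, where the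
    weight is \<open>p t\<close>; so the weight can be pulled out of the series.\<close>
  have "cos_sign (Suc n) * s ^ Suc n * (weight n t * iter_int n t) =
      - (s * p t) * (sin_sign n * s ^ n * iter_int n t)" for n
    by (simp add: sign_Suc) (simp add: sin_sign_def weight_def)
  then have "(\<Sum>n. cos_sign (Suc n) * s ^ Suc n * (weight n t * iter_int n t)) = - (s * p t * osc_sin s t)"
    using suminf_mult[OF osc_series_summable[OF sign_bound(2) s t], of "- (s * p t)"]
    by (simp add: osc_series_def)
  with osc_series_deriv[where c = cos_sign, OF sign_bound(1) s t] show ?thesis by simp
qed

lemma osc_sin_deriv:
  assumes s: "0 \<le> s" and t: "t \<in> {a..b}"
  shows "(osc_sin s has_real_derivative s * osc_cos s t / p t) (at t within {a..b})"
proof -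
  \<comment> \<open>Here only even \<open>n\<close> survive, and the weight is
    \<open>1 / p t\<close>.\<close>
  have "sin_sign (Suc n) * s ^ Suc n * (weight n t * iter_int n t) =
      s / p t * (cos_sign n * s ^ n * iter_int n t)" for n
    by (simp add: sign_Suc) (simp add: cos_sign_def weight_def)
  then have "(\<Sum>n. sin_sign (Suc n) * s ^ Suc n * (weight n t * iter_int n t)) = s * osc_cos s t / p t"
    using suminf_mult[OF osc_series_summable[OF sign_bound(1) s t], of "s / p t"]
    by (simp add: osc_series_def)
  with osc_series_deriv[where c = sin_sign, OF sign_bound(2) s t] show ?thesis by simp
qed

lemma osc_series_left: "osc_series c s a = c 0"
proof -
  have "iter_int n a = (if n = 0 then 1 else 0)" for n by (cases n) auto
  then have "(\<lambda>n. c n * s ^ n * iter_int n a) = (\<lambda>n. if n = 0 then c 0 else 0)"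
    by auto
  then show ?thesis
    using sums_If_finite_set[of "{0}" "\<lambda>_. c 0"] by (simp add: osc_series_def sums_iff)
qed

lemma osc_left: "osc_cos s a = 1" "osc_sin s a = 0"
  by (simp_all add: osc_series_left cos_sign_def sin_sign_def)

text \<open>A Gronwall argument: the derivative \<open>2 s A B (1 / p - p)\<close> of
  \<open>A^2 + B^2\<close> is at least \<open>- s K (A^2 + B^2)\<close>, so multiplying by
  \<open>exp (s * K * t)\<close> gives a nondecreasing function, positive at
  \<open>a\<close>.\<close>

lemma osc_amplitude_pos:
  assumes s: "0 \<le> s" and t: "t \<in> {a..b}"
  shows "(osc_cos s t)\<^sup>2 + (osc_sin s t)\<^sup>2 > 0"
proof -
  define E where "E t = ((osc_cos s t)\<^sup>2 + (osc_sin s t)\<^sup>2) * exp (s * K * t)" for t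
  define E' where "E' t = (2 * s * (osc_cos s t * osc_sin s t) * (1 / p t - p t) +
     s * K * ((osc_cos s t)\<^sup>2 + (osc_sin s t)\<^sup>2)) * exp (s * K * t)" for t
  have E': "(E has_real_derivative E' x) (at x within {a..b})" if x: "x \<in> {a..b}" for x
    unfolding E_def E'_def
    by (rule derivative_eq_intros osc_cos_deriv osc_sin_deriv s x refl)+
      (use p_pos[OF x] in \<open>simp add: field_simps power2_eq_square\<close>)
  have nonneg: "E' x \<ge> 0" if x: "x \<in> {a..b}" for x
  proof -
    let ?A = "osc_cos s x" and ?B = "osc_sin s x"
    have "1 / p x > 0" using p_pos[OF x] by simp
    \<comment> \<open>Both numbers lie between 0 and \<open>K\<close>, hence so does their
      distance.\<close>
    then have "\<bar>1 / p x - p x\<bar> \<le> K" using K(2,3)[OF x] p_pos[OF x] by linarith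
    moreover have "\<bar>2 * (?A * ?B)\<bar> \<le> ?A\<^sup>2 + ?B\<^sup>2"
      using sum_squares_bound[of ?A ?B] sum_squares_bound[of "- ?A" ?B] by (simp add: abs_le_iff)
    ultimately have "\<bar>2 * (?A * ?B)\<bar> * \<bar>1 / p x - p x\<bar> \<le> (?A\<^sup>2 + ?B\<^sup>2) * K"
      by (intro mult_mono) auto
    then have "- (2 * (?A * ?B) * (1 / p x - p x)) \<le> (?A\<^sup>2 + ?B\<^sup>2) * K"
      unfolding abs_mult[symmetric] by (rule abs_le_D2)
    then have "0 \<le> s * (2 * (?A * ?B) * (1 / p x - p x) + K * (?A\<^sup>2 + ?B\<^sup>2))"
      using s by (intro mult_nonneg_nonneg) (simp_all add: mult.commute)
    then have "0 \<le> 2 * s * (?A * ?B) * (1 / p x - p x) + s * K * (?A\<^sup>2 + ?B\<^sup>2)"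
      by (simp only: distrib_left mult_ac)
    then show ?thesis unfolding E'_def by (rule mult_nonneg_nonneg) simp
  qed
  have "E a \<le> E t"
  proof (rule DERIV_nonneg_imp_increasing_open[of a t E])
    show "a \<le> t" using t by simp
    show "\<exists>y. (E has_real_derivative y) (at x) \<and> 0 \<le> y" if "a < x" "x < t" for x
      using E'[of x] nonneg[of x] that t at_within_Icc_at[of a x b] by auto
    show "continuous_on {a..t} E"
      using DERIV_continuous_on[OF E'] by (rule continuous_on_subset) (use t in auto)
  qed
  moreover have "E a > 0" by (simp add: E_def osc_left)
  ultimately have "E t > 0" by simp
  then show ?thesis by (simp add: E_def zero_less_mult_iff)
qed

section \<open>The Pruefer angle and its growth in \<open>s\<close>\<close>

definition phase_rate :: "real \<Rightarrow> real \<Rightarrow> real" where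
  "phase_rate s t = s * ((osc_cos s t)\<^sup>2 / p t + p t * (osc_sin s t)\<^sup>2) / ((osc_cos s t)\<^sup>2 + (osc_sin s t)\<^sup>2)"

text \<open>\<open>phase_rate\<close> is \<open>(A B' - B A') / (A^2 + B^2)\<close>, the derivative
  of the argument of \<open>A + i B\<close>. Integrating it from \<open>a\<close> gives a continuous
  angle without choosing a branch.\<close>

definition phase :: "real \<Rightarrow> real \<Rightarrow> real" where
  "phase s t = integral {a..t} (phase_rate s)"

lemma phase_rate_cont: "continuous_on ({0..S} \<times> {a..b}) (\<lambda>(s, t). phase_rate s t)"
proof -
  have "continuous_on ({0..S} \<times> {a..b}) (\<lambda>x. osc_cos (fst x) (snd x))"
    "continuous_on ({0..S} \<times> {a..b}) (\<lambda>x. osc_sin (fst x) (snd x))"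
    using osc_series_cont[OF sign_bound(1)] osc_series_cont[OF sign_bound(2)] by (simp_all add: split_def)
  moreover have "continuous_on ({0..S} \<times> {a..b}) (\<lambda>x. p (snd x))"
    by (intro continuous_on_compose2[OF p_cont] continuous_intros) auto
  ultimately have "continuous_on ({0..S} \<times> {a..b}) (\<lambda>x. phase_rate (fst x) (snd x))"
    unfolding phase_rate_def
    by (intro continuous_intros) (use osc_amplitude_pos p_pos in \<open>force simp: less_le\<close>)+
  then show ?thesis by (simp add: split_def)
qed

lemma phase_rate_cont':
  assumes "0 \<le> s"
  shows "continuous_on {a..b} (phase_rate s)"
proof -
  have "Pair s ` {a..b} \<subseteq> {0..s} \<times> {a..b}" using assms by auto
  with continuous_on_compose2[OF phase_rate_cont[of s], of "{a..b}" "Pair s"] show ?thesis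
    by (simp add: continuous_on_Pair continuous_on_const continuous_on_id)
qed

lemma phase_deriv:
  assumes "0 \<le> s" "t \<in> {a..b}"
  shows "(phase s has_real_derivative phase_rate s t) (at t within {a..b})"
  unfolding phase_def[abs_def]
  by (intro integral_has_real_derivative phase_rate_cont' assms)

text \<open>At \<open>b\<close> the phase relation reads \<open>A sin = B cos\<close>; a zero of the
  sine kills the left side and makes the cosine nonzero.\<close>

lemma osc_sin_zero:
  assumes s: "0 \<le> s" and "sin (phase s b) = 0"
  shows "osc_sin s b = 0"
proof -
  have "osc_cos s b * sin (phase s b) = osc_sin s b * cos (phase s b)"
  proof (rule phase_relation[OF osc_cos_deriv[OF s] osc_sin_deriv[OF s] phase_deriv[OF s] osc_amplitude_pos[OF s]])
    show "phase_rate s t * ((osc_cos s t)\<^sup>2 + (osc_sin s t)\<^sup>2) =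
         osc_cos s t * (s * osc_cos s t / p t) - osc_sin s t * - (s * p t * osc_sin s t)" if "t \<in> {a..b}" for t
    proof -
      have "phase_rate s t * ((osc_cos s t)\<^sup>2 + (osc_sin s t)\<^sup>2) = s * ((osc_cos s t)\<^sup>2 / p t + p t * (osc_sin s t)\<^sup>2)"
        using osc_amplitude_pos[OF s that] unfolding phase_rate_def by simp
      then show ?thesis by (simp add: power2_eq_square algebra_simps)
    qed
  qed (use ab in \<open>auto simp: phase_def osc_left\<close>)
  moreover have "cos (phase s b) \<noteq> 0"
    using assms(2) sin_cos_squared_add[of "phase s b"] by auto
  ultimately show ?thesis using assms(2) by simp
qed

text \<open>The rate is \<open>s\<close> times an average of \<open>1 / p\<close> and
  \<open>p\<close> with weights \<open>A^2\<close> and \<open>B^2\<close>, and both are at least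
  \<open>1 / K\<close>.\<close>

lemma phase_lower:
  assumes s: "0 \<le> s"
  shows "s / K * (b - a) \<le> phase s b"
proof -
  have "s / K \<le> phase_rate s t" if t: "t \<in> {a..b}" for t
  proof -
    let ?A = "osc_cos s t" and ?B = "osc_sin s t"
    have "1 / K \<le> p t" "1 / K \<le> 1 / p t"
      using K(1) K(2,3)[OF t] p_pos[OF t] by (auto simp: field_simps)
    then have "1 / K * ?A\<^sup>2 + 1 / K * ?B\<^sup>2 \<le> 1 / p t * ?A\<^sup>2 + p t * ?B\<^sup>2"
      by (intro add_mono mult_right_mono) auto
    then have "s * (1 / K * ?A\<^sup>2 + 1 / K * ?B\<^sup>2) \<le> s * (1 / p t * ?A\<^sup>2 + p t * ?B\<^sup>2)"
      using s by (rule mult_left_mono)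
    then have "s / K * (?A\<^sup>2 + ?B\<^sup>2) \<le> s * (?A\<^sup>2 / p t + p t * ?B\<^sup>2)"
      by (simp add: algebra_simps)
    then show ?thesis
      unfolding phase_rate_def using osc_amplitude_pos[OF s t] by (simp add: pos_le_divide_eq)
  qed
  moreover have "phase_rate s integrable_on {a..b}"
    by (intro integrable_continuous_real phase_rate_cont' s)
  ultimately have "integral {a..b} (\<lambda>_. s / K) \<le> phase s b"
    unfolding phase_def by (intro integral_le) auto
  then show ?thesis using ab by (simp add: mult.commute)
qed

theorem infinite_osc_sin_zeros: "infinite {s. 0 < s \<and> osc_sin s b = 0}"
proof
  assume fin: "finite {s. 0 < s \<and> osc_sin s b = 0}"
  have "real (Suc n) * pi \<in> (\<lambda>s. phase s b) ` {s. 0 < s \<and> osc_sin s b = 0}" for n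
  proof -
    \<comment> \<open>Solves \<open>S / K * (b - a) = real (Suc n) * pi\<close>, so that
      \<open>phase_lower\<close> brings the angle at \<open>S\<close> up to the target of the
      intermediate value theorem.\<close>
    define S where "S = real (Suc n) * pi * K / (b - a)"
    have S: "S \<ge> 0" using K(1) ab by (simp add: S_def)
    have 0: "phase 0 b = 0" by (simp add: phase_def phase_rate_def[abs_def])
    have "continuous_on {0..S} (\<lambda>s. phase s b)"
      unfolding phase_def using integral_continuous_on_param[of "{0..S}" a b phase_rate] phase_rate_cont[of S]
      by simp
    moreover have "real (Suc n) * pi \<le> phase S b"
      using phase_lower[OF S] K(1) ab by (simp add: S_def)
    ultimately obtain s where s: "0 \<le> s" "s \<le> S" "phase s b = real (Suc n) * pi"
      using IVT'[of "\<lambda>s. phase s b" 0 "real (Suc n) * pi" S] S 0 pi_ge_zero by (metis mult_nonneg_nonneg of_nat_0_le_iff)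
    \<comment> \<open>This is why the multiples of \<open>pi\<close> start at 1: the multiple 0 is
      already attained at \<open>s = 0\<close>.\<close>
    have "s \<noteq> 0"
    proof
      assume "s = 0"
      with s(3) 0 have "real (Suc n) * pi = 0" by simp
      then show False using pi_gt_zero by simp
    qed
    moreover have "osc_sin s b = 0"
      by (rule osc_sin_zero[OF s(1)]) (simp only: s(3) sin_npi)
    ultimately show ?thesis using s(1,3) by (intro image_eqI[of _ _ s]) auto
  qed
  then have "range (\<lambda>n. real (Suc n) * pi) \<subseteq> (\<lambda>s. phase s b) ` {s. 0 < s \<and> osc_sin s b = 0}"
    by blast
  then have "finite (range (\<lambda>n. real (Suc n) * pi))"
    using fin by (meson finite_imageI finite_subset)
  moreover have "inj (\<lambda>n. real (Suc n) * pi)" by (auto simp: inj_on_def)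
  ultimately show False using finite_imageD infinite_UNIV_nat by blast
qed

end

subsection \<open>The form along a continuous path\<close>

locale continuous_path =
  fixes a b :: real and w :: "real \<Rightarrow> real"
  assumes ab: "a < b" and w_cont: "continuous_on {a..b} w"
begin

definition p :: "real \<Rightarrow> real" where "p t = exp (integral {a..t} w)"

lemma p_has_derivative: "t \<in> {a..b} \<Longrightarrow> (p has_real_derivative w t * p t) (at t within {a..b})"
  unfolding p_def by (auto intro!: derivative_eq_intros integral_has_real_derivative w_cont)

lemma p_positive: "p t > 0" and p_nonzero: "p t \<noteq> 0"
  by (simp_all add: p_def)

lemma p_continuous: "continuous_on {a..b} p"
  using p_has_derivative by (rule DERIV_continuous_on)

sublocale sturm_liouville a b p
  using ab p_continuous p_positive by unfold_locales

lemma recip_deriv: "t \<in> {a..b} \<Longrightarrow> ((\<lambda>t. 1 / p t) has_real_derivative - (w t / p t)) (at t within {a..b})"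
  using p_positive[of t] by (auto intro!: derivative_eq_intros p_has_derivative simp: field_simps)

lemma recip_deriv_cont: "continuous_on {a..b} (\<lambda>t. - (w t / p t))"
  by (intro continuous_intros w_cont p_continuous) (use p_positive in \<open>auto simp: less_le\<close>)

text \<open>Collecting the terms with \<open>deriv h\<close> leaves the flux
  \<open>e' - w e\<close>. Any almost everywhere version \<open>F\<close> is allowed:
  \<open>p u'\<close> in the countability proof, \<open>s * osc_cos s\<close> for the explicit
  eigenfunctions.\<close>

lemma eps_form_flux:
  assumes e: "e \<in> H1 a b" and h: "h \<in> H1 a b"
    and flux: "AE t in lebesgue_on {a..b}. deriv e t - w t * e t = F t"
  shows "eps_form a b w e h = - integral\<^sup>L (lebesgue_on {a..b}) (\<lambda>t. F t * deriv h t)"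
proof -
  have sq: "sq_integrable a b (deriv e)" "sq_integrable a b (deriv h)" "sq_integrable a b e"
    using e h by (auto simp: H1_def)
  have we: "integrable (lebesgue_on {a..b}) (\<lambda>t. w t * e t * deriv h t)"
    by (intro sq_integrable_mult sq_integrable_continuous_mult w_cont sq)
  have F: "integrable (lebesgue_on {a..b}) (\<lambda>t. deriv e t * deriv h t - w t * e t * deriv h t)"
    by (intro Bochner_Integration.integrable_diff sq_integrable_mult[OF sq(1,2)] we)
  have "sq_integrable a b F"
  proof (rule sq_integrable_cong_AE)
    show "sq_integrable a b (\<lambda>t. deriv e t + (- w t) * e t)"
      by (intro sq_integrable_add sq_integrable_continuous_mult continuous_intros w_cont sq)
    show "AE t in lebesgue_on {a..b}. F t = deriv e t + (- w t) * e t"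
      using flux by eventually_elim simp
  qed
  then have Fm: "(\<lambda>t. F t * deriv h t) \<in> borel_measurable (lebesgue_on {a..b})"
    using sq(2) sq_integrable_mult by blast
  have "integral\<^sup>L (lebesgue_on {a..b}) (\<lambda>t. F t * deriv h t) =
      integral\<^sup>L (lebesgue_on {a..b}) (\<lambda>t. deriv e t * deriv h t - w t * e t * deriv h t)"
    by (rule integral_cong_AE[OF Fm borel_measurable_integrable[OF F]])
      (use flux in \<open>eventually_elim, simp flip: left_diff_distrib\<close>)
  also have "\<dots> = - eps_form a b w e h"
    using sq_integrable_mult[OF sq(1,2)] we
    by (simp add: eps_form_def set_lebesgue_integral_lebesgue_on mult_ac)
  finally show ?thesis by simp
qed

text \<open>\<open>p\<close> is an integrating factor: as \<open>p' = w p\<close>, the product rule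
  for \<open>1 / p * e\<close> absorbs the term \<open>w e\<close>.\<close>

lemma H1_div:
  assumes "e \<in> H1 a b"
  shows "(\<lambda>t. e t / p t) \<in> H1 a b"
    "AE t in lebesgue_on {a..b}. deriv e t - w t * e t = p t * deriv (\<lambda>t. e t / p t) t"
proof -
  have "(\<lambda>t. 1 / p t * e t) \<in> H1 a b"
    by (rule H1_mult_C1(1)[OF assms recip_deriv recip_deriv_cont])
  then show "(\<lambda>t. e t / p t) \<in> H1 a b" by simp
  have "AE t in lebesgue_on {a..b}. deriv (\<lambda>t. 1 / p t * e t) t = - (w t / p t) * e t + 1 / p t * deriv e t"
    by (rule H1_mult_C1(2)[OF assms recip_deriv recip_deriv_cont])
  then show "AE t in lebesgue_on {a..b}. deriv e t - w t * e t = p t * deriv (\<lambda>t. e t / p t) t"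
  proof eventually_elim
    case (elim t)
    then have "p t * deriv (\<lambda>t. e t / p t) t = p t * (- (w t / p t) * e t + 1 / p t * deriv e t)" by simp
    also have "\<dots> = deriv e t - w t * e t" using p_positive[of t] by (simp add: field_simps)
    finally show ?case ..
  qed
qed

lemma countable_weak_eigenvalues: "countable {\<mu>. weak_eigenvalue a b w \<mu>}" (is "countable ?\<Lambda>")
proof -
  have "\<forall>\<mu>\<in>?\<Lambda>. \<exists>e. e \<in> H1 a b \<and> (\<exists>t\<in>{a..b}. e t \<noteq> 0) \<and>
        (\<forall>h\<in>H1 a b. eps_form a b w e h = L2_inner a b (\<lambda>t. \<mu> * e t) h)"
    unfolding weak_eigenvalue_def by blast
  from bchoice[OF this] obtain e where e: "\<And>\<mu>. \<mu> \<in> ?\<Lambda> \<Longrightarrow> e \<mu> \<in> H1 a b"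
      "\<And>\<mu>. \<mu> \<in> ?\<Lambda> \<Longrightarrow> \<exists>t\<in>{a..b}. e \<mu> t \<noteq> 0"
      "\<And>\<mu> h. \<mu> \<in> ?\<Lambda> \<Longrightarrow> h \<in> H1 a b \<Longrightarrow> eps_form a b w (e \<mu>) h = L2_inner a b (\<lambda>t. \<mu> * e \<mu> t) h"
    by blast
  define u where "u \<mu> t = e \<mu> t / p t" for \<mu> t
  have u: "u \<mu> \<in> H1 a b" if "\<mu> \<in> ?\<Lambda>" for \<mu>
    using H1_div(1)[OF e(1)[OF that]] by (simp add: u_def[abs_def])
  \<comment> \<open>The relation for \<open>e \<mu>\<close> is tested with \<open>u \<nu>\<close>.
    Since \<open>e \<mu> = p u \<mu>\<close>, both integrals are symmetric in the two indices, and
    exchanging them forces orthogonality for distinct eigenvalues.\<close>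
  have weak: "integral\<^sup>L (lebesgue_on {a..b}) (\<lambda>t. p t * deriv (u \<mu>) t * deriv (u \<nu>) t) =
       - \<mu> * integral\<^sup>L (lebesgue_on {a..b}) (\<lambda>t. p t * (u \<mu> t * u \<nu> t))" if "\<mu> \<in> ?\<Lambda>" "\<nu> \<in> ?\<Lambda>" for \<mu> \<nu>
  proof -
    have "AE t in lebesgue_on {a..b}. deriv (e \<mu>) t - w t * e \<mu> t = p t * deriv (u \<mu>) t"
      using H1_div(2)[OF e(1)[OF that(1)]] by (simp add: u_def[abs_def])
    from eps_form_flux[OF e(1)[OF that(1)] u[OF that(2)] this]
    have "integral\<^sup>L (lebesgue_on {a..b}) (\<lambda>t. p t * deriv (u \<mu>) t * deriv (u \<nu>) t) =
       - L2_inner a b (\<lambda>t. \<mu> * e \<mu> t) (u \<nu>)"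
      using e(3)[OF that(1) u[OF that(2)]] by simp
    also have "L2_inner a b (\<lambda>t. \<mu> * e \<mu> t) (u \<nu>) =
        integral\<^sup>L (lebesgue_on {a..b}) (\<lambda>t. \<mu> * (p t * (u \<mu> t * u \<nu> t)))"
      unfolding L2_inner_def set_lebesgue_integral_lebesgue_on
      by (intro Bochner_Integration.integral_cong) (simp_all add: u_def p_nonzero)
    finally show ?thesis by simp
  qed
  \<comment> \<open>The factor \<open>sqrt (p t)\<close> turns the weighted product of the
    derivatives into an ordinary \<open>L\<^sub>2\<close> product.\<close>
  define v where "v \<mu> t = sqrt (p t) * deriv (u \<mu>) t" for \<mu> t
  have sqrt_cont: "continuous_on {a..b} (\<lambda>t. sqrt (p t))"
    by (intro continuous_intros p_continuous)
  have v: "sq_integrable a b (v \<mu>)" if "\<mu> \<in> ?\<Lambda>" for \<mu>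
    unfolding v_def using u[OF that] by (intro sq_integrable_continuous_mult sqrt_cont) (simp add: H1_def)
  have vv: "v \<mu> t * v \<nu> t = p t * deriv (u \<mu>) t * deriv (u \<nu>) t" for \<mu> \<nu> t
  proof -
    have "v \<mu> t * v \<nu> t = (sqrt (p t) * sqrt (p t)) * deriv (u \<mu>) t * deriv (u \<nu>) t"
      by (simp add: v_def)
    then show ?thesis using p_positive[of t] by simp
  qed
  have orth: "(\<integral>t. v \<mu> t * v \<nu> t \<partial>lebesgue_on {a..b}) = 0"
    if "\<mu> \<in> ?\<Lambda>" "\<nu> \<in> ?\<Lambda>" "\<mu> \<noteq> \<nu>" for \<mu> \<nu>
  proof -
    define J where "J = (\<integral>t. p t * (u \<mu> t * u \<nu> t) \<partial>lebesgue_on {a..b})"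
    have "(\<integral>t. v \<mu> t * v \<nu> t \<partial>lebesgue_on {a..b}) = - \<mu> * J"
      unfolding vv J_def by (rule weak[OF that(1,2)])
    moreover have "(\<integral>t. v \<nu> t * v \<mu> t \<partial>lebesgue_on {a..b}) = - \<nu> * J"
      unfolding vv J_def mult.commute[of "u \<mu> _"] by (rule weak[OF that(2,1)])
    moreover have "v \<nu> t * v \<mu> t = v \<mu> t * v \<nu> t" for t by (rule mult.commute)
    ultimately show ?thesis using that(3) by auto
  qed
  \<comment> \<open>\<open>1 / sqrt (p t)\<close> cancels the factor in \<open>v\<close>, so the
    product of \<open>g x\<close> with \<open>v \<mu>\<close> integrates to
    \<open>u \<mu> x\<close>.\<close>
  define g where "g x t = indicator {a..x} t * (1 / sqrt (p t))" for x t :: real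
  have "countable {\<mu> \<in> ?\<Lambda>. u \<mu> x \<noteq> 0}" if x: "x \<in> {a..b}" for x
  proof -
    have "continuous_on {a..b} (\<lambda>t. 1 / sqrt (p t))"
      by (intro continuous_intros p_continuous) (use p_positive in \<open>auto simp: less_le\<close>)
    from sq_integrable_continuous_mult[OF this sq_integrable_indicator[OF x]]
    have "sq_integrable a b (\<lambda>t. (1 / sqrt (p t)) * indicator {a..x} t)" .
    then have g: "sq_integrable a b (g x)" by (simp add: g_def[abs_def] mult.commute)
    have "g x t * v \<mu> t = indicator {a..x} t * deriv (u \<mu>) t" for \<mu> t
      using p_positive[of t] by (simp add: g_def v_def)
    then have "(\<integral>t. g x t * v \<mu> t \<partial>lebesgue_on {a..b}) = u \<mu> x" if "\<mu> \<in> ?\<Lambda>" for \<mu>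
      using H1_ftc[OF u[OF that] x] by simp
    then have "{\<mu> \<in> ?\<Lambda>. u \<mu> x \<noteq> 0} = {\<mu> \<in> ?\<Lambda>. (\<integral>t. g x t * v \<mu> t \<partial>lebesgue_on {a..b}) \<noteq> 0}"
      by (intro Collect_cong conj_cong) auto
    moreover have "countable \<dots>"
      by (intro countable_nonorthogonal sq_integrable_mult g v orth)
    ultimately show ?thesis by simp
  qed
  then have "countable (\<Union>x\<in>\<rat> \<inter> {a..b}. {\<mu> \<in> ?\<Lambda>. u \<mu> x \<noteq> 0})"
    using countable_rat by (intro countable_UN) (auto intro: countable_subset)
  moreover have "?\<Lambda> \<subseteq> (\<Union>x\<in>\<rat> \<inter> {a..b}. {\<mu> \<in> ?\<Lambda>. u \<mu> x \<noteq> 0})"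
  proof
    fix \<mu> assume \<mu>: "\<mu> \<in> ?\<Lambda>"
    obtain t where t: "t \<in> {a..b}" "e \<mu> t \<noteq> 0" using e(2)[OF \<mu>] by blast
    \<comment> \<open>Rational points are sought to the left of \<open>t\<close>; since
      \<open>e \<mu>\<close> vanishes at \<open>a\<close>, there is room there inside the interval,
      and continuity keeps \<open>e \<mu>\<close> nonzero.\<close>
    have "t \<noteq> a" using e(1)[OF \<mu>] t(2) by (auto simp: H1_def)
    obtain \<delta> where \<delta>: "\<delta> > 0" "\<And>y. y \<in> {a..b} \<Longrightarrow> dist y t < \<delta> \<Longrightarrow> dist (e \<mu> y) (e \<mu> t) < \<bar>e \<mu> t\<bar>"
      using H1_continuous[OF e(1)[OF \<mu>]] t unfolding continuous_on_iff by (metis zero_less_abs_iff)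
    have "max a (t - \<delta>) < t" using t(1) \<open>t \<noteq> a\<close> \<delta>(1) by auto
    then obtain x where x: "x \<in> \<rat>" "max a (t - \<delta>) < x" "x < t" using Rats_dense_in_real by blast
    have "e \<mu> x \<noteq> 0" using \<delta>(2)[of x] x t(1) by (auto simp: dist_real_def)
    then have "u \<mu> x \<noteq> 0" using p_positive[of x] by (simp add: u_def)
    with x t(1) \<mu> show "\<mu> \<in> (\<Union>x\<in>\<rat> \<inter> {a..b}. {\<mu> \<in> ?\<Lambda>. u \<mu> x \<noteq> 0})" by auto
  qed
  ultimately show ?thesis by (rule countable_subset[rotated])
qed

lemma weak_eigenvalue_osc_sin:
  assumes s: "0 < s" and zero: "osc_sin s b = 0"
  shows "weak_eigenvalue a b w (- s\<^sup>2)"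
proof -
  have s0: "0 \<le> s" using s by simp
  \<comment> \<open>Undoes the substitution \<open>u = e / p\<close> with \<open>u\<close> taken as
    \<open>osc_sin s\<close>; then \<open>p B' = s A\<close> makes the flux of \<open>e\<close>
    equal to \<open>s * osc_cos s\<close>.\<close>
  define e where "e t = p t * osc_sin s t" for t
  have cos_cont: "continuous_on {a..b} (osc_cos s)"
    using osc_cos_deriv[OF s0] by (rule DERIV_continuous_on)
  have sin_cont: "continuous_on {a..b} (osc_sin s)"
    using osc_sin_deriv[OF s0] by (rule DERIV_continuous_on)
  have e_deriv: "(e has_real_derivative w t * e t + s * osc_cos s t) (at t within {a..b})" if "t \<in> {a..b}" for t
    unfolding e_def using p_positive[of t]
    by (auto intro!: derivative_eq_intros p_has_derivative osc_sin_deriv s0 that simp: field_simps)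
  have e_cont: "continuous_on {a..b} (\<lambda>t. w t * e t + s * osc_cos s t)"
    unfolding e_def by (intro continuous_intros w_cont p_continuous sin_cont cos_cont)
  have ends: "e a = 0" "e b = 0" by (simp_all add: e_def osc_left zero)
  have e: "e \<in> H1 a b" "AE t in lebesgue_on {a..b}. deriv e t = w t * e t + s * osc_cos s t"
    by (rule H1_C1[OF e_deriv e_cont ends]; assumption)+
  have flux: "AE t in lebesgue_on {a..b}. deriv e t - w t * e t = s * osc_cos s t"
    using e(2) by eventually_elim simp
  have "eps_form a b w e h = L2_inner a b (\<lambda>t. - s\<^sup>2 * e t) h" if h: "h \<in> H1 a b" for h
  proof -
    have A': "continuous_on {a..b} (\<lambda>t. - (s * p t * osc_sin s t))"
      by (intro continuous_intros p_continuous sin_cont)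
    have Ah: "(\<lambda>t. osc_cos s t * h t) \<in> H1 a b" "AE t in lebesgue_on {a..b}.
        deriv (\<lambda>t. osc_cos s t * h t) t = - (s * p t * osc_sin s t) * h t + osc_cos s t * deriv h t"
      by (rule H1_mult_C1[OF h osc_cos_deriv[OF s0] A']; assumption)+
    have sq: "sq_integrable a b (deriv h)" "sq_integrable a b h" using h by (auto simp: H1_def)
    have i1: "integrable (lebesgue_on {a..b}) (\<lambda>t. osc_cos s t * deriv h t)"
      using sq_integrable_mult[OF continuous_sq_integrable[OF cos_cont] sq(1)] .
    have i2: "integrable (lebesgue_on {a..b}) (\<lambda>t. - (s * p t * osc_sin s t) * h t)"
      using sq_integrable_mult[OF continuous_sq_integrable[OF A'] sq(2)] .
    \<comment> \<open>Integration by parts: \<open>osc_cos s t * h t\<close> vanishes at both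
      endpoints because \<open>h\<close> does, so its derivative has integral 0.\<close>
    have "0 = integral\<^sup>L (lebesgue_on {a..b}) (\<lambda>t. indicator {a..b} t * deriv (\<lambda>t. osc_cos s t * h t) t)"
      using H1_ftc[OF Ah(1), of b] ab h by (simp add: H1_def)
    also have "\<dots> = integral\<^sup>L (lebesgue_on {a..b}) (deriv (\<lambda>t. osc_cos s t * h t))"
      by (intro Bochner_Integration.integral_cong) auto
    also have "\<dots> = integral\<^sup>L (lebesgue_on {a..b}) (\<lambda>t. - (s * p t * osc_sin s t) * h t + osc_cos s t * deriv h t)"
    proof (rule integral_cong_AE)
      show "deriv (\<lambda>t. osc_cos s t * h t) \<in> borel_measurable (lebesgue_on {a..b})"
        using Ah(1) by (auto simp: H1_def intro: sq_integrable_measurable)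
      show "(\<lambda>t. - (s * p t * osc_sin s t) * h t + osc_cos s t * deriv h t) \<in> borel_measurable (lebesgue_on {a..b})"
        using i1 i2 by (intro borel_measurable_add borel_measurable_integrable)
    qed (rule Ah(2))
    also have "\<dots> = integral\<^sup>L (lebesgue_on {a..b}) (\<lambda>t. - (s * p t * osc_sin s t) * h t) +
        integral\<^sup>L (lebesgue_on {a..b}) (\<lambda>t. osc_cos s t * deriv h t)"
      using i2 i1 by (rule Bochner_Integration.integral_add)
    finally have "integral\<^sup>L (lebesgue_on {a..b}) (\<lambda>t. osc_cos s t * deriv h t) =
        - integral\<^sup>L (lebesgue_on {a..b}) (\<lambda>t. - s * (e t * h t))"
      by (simp add: e_def mult_ac)
    then have parts: "integral\<^sup>L (lebesgue_on {a..b}) (\<lambda>t. osc_cos s t * deriv h t) =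
        s * integral\<^sup>L (lebesgue_on {a..b}) (\<lambda>t. e t * h t)"
      by simp
    have "eps_form a b w e h = - integral\<^sup>L (lebesgue_on {a..b}) (\<lambda>t. s * (osc_cos s t * deriv h t))"
      using eps_form_flux[OF e(1) h flux] by (simp add: mult.assoc)
    also have "\<dots> = - s\<^sup>2 * integral\<^sup>L (lebesgue_on {a..b}) (\<lambda>t. e t * h t)"
      by (simp add: parts power2_eq_square)
    also have "\<dots> = L2_inner a b (\<lambda>t. - s\<^sup>2 * e t) h"
      unfolding L2_inner_def set_lebesgue_integral_lebesgue_on by (simp add: mult.assoc)
    finally show ?thesis .
  qed
  moreover have "\<exists>t\<in>{a..b}. e t \<noteq> 0"
  proof (rule ccontr)
    assume "\<not> (\<exists>t\<in>{a..b}. e t \<noteq> 0)"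
    \<comment> \<open>If \<open>B\<close> vanished throughout, so would its derivative
      \<open>s A / p\<close> at the midpoint, and then \<open>A\<close> and \<open>B\<close> would
      both be 0 there, against \<open>osc_amplitude_pos\<close>.\<close>
    then have sin0: "osc_sin s t = 0" if "t \<in> {a..b}" for t using that by (auto simp: e_def p_nonzero)
    have "(osc_sin s has_real_derivative 0) (at ((a + b) / 2))"
      by (rule has_field_derivative_transform_within_open[OF DERIV_const open_greaterThanLessThan[of a b]])
        (use ab in \<open>auto simp: sin0\<close>)
    moreover have "(osc_sin s has_real_derivative s * osc_cos s ((a + b) / 2) / p ((a + b) / 2)) (at ((a + b) / 2))"
      using osc_sin_deriv[OF s0, of "(a + b) / 2"] ab by (simp add: at_within_Icc_at)
    ultimately have "s * osc_cos s ((a + b) / 2) / p ((a + b) / 2) = 0"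
      using DERIV_unique by blast
    then have "osc_cos s ((a + b) / 2) = 0" using s by (simp add: p_nonzero)
    moreover have "osc_sin s ((a + b) / 2) = 0" using sin0 ab by simp
    ultimately show False using osc_amplitude_pos[OF s0, of "(a + b) / 2"] ab by simp
  qed
  ultimately show ?thesis unfolding weak_eigenvalue_def using e(1) by blast
qed

lemma infinite_weak_eigenvalues: "infinite {\<mu>. weak_eigenvalue a b w \<mu>}"
proof -
  have "inj_on (\<lambda>s. - s\<^sup>2) {s::real. 0 < s \<and> osc_sin s b = 0}"
    by (auto simp: inj_on_def power2_eq_iff)
  then have "infinite ((\<lambda>s. - s\<^sup>2) ` {s. 0 < s \<and> osc_sin s b = 0})"
    using infinite_osc_sin_zeros finite_imageD by blast
  moreover have "(\<lambda>s. - s\<^sup>2) ` {s. 0 < s \<and> osc_sin s b = 0} \<subseteq> {\<mu>. weak_eigenvalue a b w \<mu>}"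
    using weak_eigenvalue_osc_sin by blast
  ultimately show ?thesis by (rule infinite_super[rotated])
qed

end

theorem corollary6:
  fixes M :: "'a measure" and a b :: real and W :: "real \<Rightarrow> 'a \<Rightarrow> real"
  assumes "a < b"
    and "brownian_motion M a b W"
  shows "AE \<omega> in M. countable {\<mu>. weak_eigenvalue a b (\<lambda>t. W t \<omega>) \<mu>} \<and>
                     infinite {\<mu>. weak_eigenvalue a b (\<lambda>t. W t \<omega>) \<mu>}"
  using brownian_motion.continuous_paths[OF assms(2)]
proof eventually_elim
  case (elim \<omega>)
  \<comment> \<open>From here on the path is one fixed continuous function.\<close>
  then interpret continuous_path a b "\<lambda>t. W t \<omega>"
    using assms(1) by unfold_locales
  show ?case using countable_weak_eigenvalues infinite_weak_eigenvalues by blast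
qed

end
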